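(* Let $G=N\rtimes H$ be a semidirect product of groups (with $N$ normal in $G$), and let $p:G\to H$ be the natural projection. Then the following hold. (i) $G\otimes G\cong K_1\rtimes(H\otimes H)$, where $K_1$ is the normal subgroup of $G\otimes G$ generated by $\{g\otimes n,\ n_1\otimes g_1 \mid g,g_1\in G,\ n,n_1\in N\}$. (ii) $G\wedge G\cong K_2\rtimes(H\wedge H)$, where $K_2$ is the normal subgroup of $G\wedge G$ generated by $\{g\wedge n\mid g\in G,\ n\in N\}$. (iii) $\nabla(G)\cong K_3\times\nabla(H)$, where $K_3=\langle (g\otimes n)(n\otimes g),\ n_1\otimes n_1 \mid g\in G,\ n,n_1\in N\rangle$. (iv) $\Delta(G)\cong K_4\times\Delta(H)$, where $K_4=\ker\big((p\otimes p)|_{\Delta(G)}\big)$. (v) $G\,\widetilde{\otimes}\,G\cong K_5\rtimes(H\,\widetilde{\otimes}\,H)$, where $K_5=\langle (g\otimes n)\Delta(G)\mid g\in G,\ n\in N\rangle$.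
   Context: For a group $G$ write ${}^{g}g'=gg'g^{-1}$. The nonabelian tensor square $G\otimes G$ is the group generated by symbols $g\otimes h$ ($g,h\in G$) with relations $gg'\otimes h=({}^gg'\otimes{}^gh)(g\otimes h)$ and $g\otimes hh'=(g\otimes h)({}^hg\otimes{}^hh')$ for all $g,g',h,h'\in G$. $\nabla(G)$ is the subgroup of $G\otimes G$ generated by all $x\otimes x$ ($x\in G$), and $\Delta(G)$ is the subgroup generated by all $(x\otimes y)(y\otimes x)$ ($x,y\in G$); both are central in $G\otimes G$. Put $G\wedge G=(G\otimes G)/\nabla(G)$, with $g\wedge h$ the image of $g\otimes h$, and $G\,\widetilde{\otimes}\,G=(G\otimes G)/\Delta(G)$. The homomorphism $p\otimes p:G\otimes G\to H\otimes H$ is given by $g\otimes h\mapsto p(g)\otimes p(h)$. *)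

theory Defs
  imports "HOL-Algebra.Generated_Groups" "HOL-Algebra.Bij"
begin

section \<open>Groups given by generators and relations\<close>

text \<open>A letter \<^term>\<open>(s, True)\<close> stands for the generator \<^term>\<open>s\<close> and \<^term>\<open>(s, False)\<close> for its
  formal inverse.  The relation below is the least congruence on words over \<^term>\<open>S\<close> that contains
  free cancellation and the defining relations, so its classes are the elements of the group
  generated by \<^term>\<open>S\<close> subject to the relations \<^term>\<open>u = v\<close> for \<^term>\<open>(u, v) \<in> R\<close>.\<close>

type_synonym 's word = "('s \<times> bool) list"

definition words :: "'s set \<Rightarrow> 's word set" where
  "words S = lists (S \<times> UNIV)"

inductive pres_eq :: "'s set \<Rightarrow> ('s word \<times> 's word) set \<Rightarrow> 's word \<Rightarrow> 's word \<Rightarrow> bool"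
  for S R where
  refl: "w \<in> words S \<Longrightarrow> pres_eq S R w w"
| sym: "pres_eq S R u v \<Longrightarrow> pres_eq S R v u"
| trans: "pres_eq S R u v \<Longrightarrow> pres_eq S R v w \<Longrightarrow> pres_eq S R u w"
| append: "pres_eq S R u u' \<Longrightarrow> pres_eq S R v v' \<Longrightarrow> pres_eq S R (u @ v) (u' @ v')"
| cancel: "s \<in> S \<Longrightarrow> pres_eq S R [(s, b), (s, \<not> b)] []"
| relation: "(u, v) \<in> R \<Longrightarrow> u \<in> words S \<Longrightarrow> v \<in> words S \<Longrightarrow> pres_eq S R u v"

definition pres_class :: "'s set \<Rightarrow> ('s word \<times> 's word) set \<Rightarrow> 's word \<Rightarrow> 's word set" where
  "pres_class S R w = {v. pres_eq S R w v}"

definition presented_group ::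
    "'s set \<Rightarrow> ('s word \<times> 's word) set \<Rightarrow> 's word set monoid" where
  "presented_group S R =
    \<lparr>carrier = pres_class S R ` words S,
     mult = (\<lambda>X Y. \<Union>u\<in>X. \<Union>v\<in>Y. pres_class S R (u @ v)),
     one = pres_class S R []\<rparr>"

lemma words_simps [simp]:
  "[] \<in> words S"
  "x # w \<in> words S \<longleftrightarrow> fst x \<in> S \<and> w \<in> words S"
  "u @ v \<in> words S \<longleftrightarrow> u \<in> words S \<and> v \<in> words S"
  by (auto simp: words_def mem_Times_iff)

lemma pres_eq_words: "pres_eq S R u v \<Longrightarrow> u \<in> words S \<and> v \<in> words S"
  by (induction rule: pres_eq.induct) auto

lemma pres_class_eq_iff:
  assumes "u \<in> words S"
  shows "pres_class S R u = pres_class S R v \<longleftrightarrow> pres_eq S R u v"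
proof
  assume "pres_class S R u = pres_class S R v"
  moreover have "u \<in> pres_class S R u"
    using assms by (simp add: pres_class_def pres_eq.refl)
  ultimately show "pres_eq S R u v"
    by (simp add: pres_class_def pres_eq.sym)
qed (auto simp: pres_class_def intro: pres_eq.sym pres_eq.trans)

lemma pres_class_Union:
  assumes "w \<in> words S"
    and "\<And>v. pres_eq S R w v \<Longrightarrow> pres_class S' R' (f w) = pres_class S' R' (f v)"
  shows "(\<Union>v\<in>pres_class S R w. pres_class S' R' (f v)) = pres_class S' R' (f w)"
proof -
  have "w \<in> pres_class S R w" using assms(1) by (simp add: pres_class_def pres_eq.refl)
  moreover have "pres_class S' R' (f v) = pres_class S' R' (f w)" if "v \<in> pres_class S R w" for v
    using that assms(2)[of v] by (simp add: pres_class_def)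
  ultimately show ?thesis by blast
qed

lemma presented_group_mult:
  assumes "u \<in> words S" "v \<in> words S"
  shows "pres_class S R u \<otimes>\<^bsub>presented_group S R\<^esub> pres_class S R v = pres_class S R (u @ v)"
proof -
  have *: "pres_class S R (u' @ v') = pres_class S R (u @ v)"
    if "u' \<in> pres_class S R u" "v' \<in> pres_class S R v" for u' v'
  proof -
    have "pres_eq S R (u @ v) (u' @ v')"
      using that by (intro pres_eq.append) (simp_all add: pres_class_def)
    then show ?thesis using assms by (metis pres_class_eq_iff words_simps(3))
  qed
  have "u \<in> pres_class S R u" "v \<in> pres_class S R v"
    using assms by (simp_all add: pres_class_def pres_eq.refl)
  then have "(\<Union>u'\<in>pres_class S R u. \<Union>v'\<in>pres_class S R v. pres_class S R (u' @ v')) =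
      pres_class S R (u @ v)"
    using * by blast
  then show ?thesis by (simp add: presented_group_def)
qed

lemma presented_group_carrier: "carrier (presented_group S R) = pres_class S R ` words S"
  by (simp add: presented_group_def)

lemma presented_group_one: "\<one>\<^bsub>presented_group S R\<^esub> = pres_class S R []"
  by (simp add: presented_group_def)

lemma pres_eq_left_inverse:
  "w \<in> words S \<Longrightarrow> pres_eq S R (rev (map (apsnd Not) w) @ w) []"
proof (induction w)
  case Nil
  then show ?case by (simp add: pres_eq.refl)
next
  case (Cons x w)
  obtain s b where x: "x = (s, b)" by (cases x)
  let ?v = "rev (map (apsnd Not) w)"
  have w: "w \<in> words S" "s \<in> S" using Cons.prems by (auto simp: x)
  have v: "?v \<in> words S" using w(1) by (induction w) auto
  have "pres_eq S R ((?v @ [(s, \<not> b), (s, b)]) @ w) ((?v @ []) @ w)"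
    using w v pres_eq.cancel[of s S R "\<not> b"] by (intro pres_eq.append pres_eq.refl) auto
  then show ?case
    using Cons.IH[OF w(1)] by (auto simp: x intro: pres_eq.trans)
qed

lemma group_presented_group: "group (presented_group S R)"
proof (rule groupI)
  fix X assume "X \<in> carrier (presented_group S R)"
  then obtain w where w: "w \<in> words S" "X = pres_class S R w"
    by (auto simp: presented_group_carrier)
  have v: "rev (map (apsnd Not) w) \<in> words S" using w(1) by (induction w) auto
  then have "pres_class S R (rev (map (apsnd Not) w)) \<otimes>\<^bsub>presented_group S R\<^esub> X = \<one>\<^bsub>presented_group S R\<^esub>"
    using w pres_eq_left_inverse[OF w(1)]
    by (simp add: presented_group_mult presented_group_one pres_class_eq_iff)
  then show "\<exists>Y\<in>carrier (presented_group S R). Y \<otimes>\<^bsub>presented_group S R\<^esub> X = \<one>\<^bsub>presented_group S R\<^esub>"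
    using v by (auto simp: presented_group_carrier)
qed (auto simp: presented_group_carrier presented_group_mult presented_group_one)


section \<open>The nonabelian tensor square and its quotients\<close>

definition conj_by :: "('a, 'b) monoid_scheme \<Rightarrow> 'a \<Rightarrow> 'a \<Rightarrow> 'a" where
  "conj_by G g x = g \<otimes>\<^bsub>G\<^esub> x \<otimes>\<^bsub>G\<^esub> inv\<^bsub>G\<^esub> g"

definition tensor_relations :: "('a, 'b) monoid_scheme \<Rightarrow> (('a \<times> 'a) word \<times> ('a \<times> 'a) word) set" where
  "tensor_relations G =
    {([((g \<otimes>\<^bsub>G\<^esub> g', h), True)],
      [((conj_by G g g', conj_by G g h), True), ((g, h), True)]) | g g' h.
        g \<in> carrier G \<and> g' \<in> carrier G \<and> h \<in> carrier G} \<union>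
    {([((g, h \<otimes>\<^bsub>G\<^esub> h'), True)],
      [((g, h), True), ((conj_by G h g, conj_by G h h'), True)]) | g h h'.
        g \<in> carrier G \<and> h \<in> carrier G \<and> h' \<in> carrier G}"

definition tensor_class :: "('a, 'b) monoid_scheme \<Rightarrow> ('a \<times> 'a) word \<Rightarrow> ('a \<times> 'a) word set" where
  "tensor_class G = pres_class (carrier G \<times> carrier G) (tensor_relations G)"

definition tensor_square :: "('a, 'b) monoid_scheme \<Rightarrow> ('a \<times> 'a) word set monoid" where
  "tensor_square G = presented_group (carrier G \<times> carrier G) (tensor_relations G)"

definition tensor :: "('a, 'b) monoid_scheme \<Rightarrow> 'a \<Rightarrow> 'a \<Rightarrow> ('a \<times> 'a) word set" where
  "tensor G g h = tensor_class G [((g, h), True)]"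

text \<open>The map \<open>f \<otimes> f\<close>, applying \<^term>\<open>f\<close> to all entries of a representing word; see
  \<open>tensor_map_hom\<close> and \<open>tensor_map_tensor\<close> below.\<close>

definition tensor_map ::
    "('c, 'd) monoid_scheme \<Rightarrow> ('a \<Rightarrow> 'c) \<Rightarrow> ('a \<times> 'a) word set \<Rightarrow> ('c \<times> 'c) word set" where
  "tensor_map H f X = (\<Union>w\<in>X. tensor_class H (map (apfst (map_prod f f)) w))"

definition nabla :: "('a, 'b) monoid_scheme \<Rightarrow> ('a \<times> 'a) word set set" where
  "nabla G = generate (tensor_square G) {tensor G x x | x. x \<in> carrier G}"

definition Delta :: "('a, 'b) monoid_scheme \<Rightarrow> ('a \<times> 'a) word set set" where
  "Delta G = generate (tensor_square G)
    {tensor G x y \<otimes>\<^bsub>tensor_square G\<^esub> tensor G y x | x y. x \<in> carrier G \<and> y \<in> carrier G}"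

definition exterior_square :: "('a, 'b) monoid_scheme \<Rightarrow> ('a \<times> 'a) word set set monoid" where
  "exterior_square G = tensor_square G Mod nabla G"

definition wedge :: "('a, 'b) monoid_scheme \<Rightarrow> 'a \<Rightarrow> 'a \<Rightarrow> ('a \<times> 'a) word set set" where
  "wedge G g h = nabla G #>\<^bsub>tensor_square G\<^esub> tensor G g h"

definition tilde_square :: "('a, 'b) monoid_scheme \<Rightarrow> ('a \<times> 'a) word set set monoid" where
  "tilde_square G = tensor_square G Mod Delta G"

lemma group_tensor_square: "group (tensor_square G)"
  by (simp add: tensor_square_def group_presented_group)

lemma tensor_closed:
  "g \<in> carrier G \<Longrightarrow> h \<in> carrier G \<Longrightarrow> tensor G g h \<in> carrier (tensor_square G)"
  by (simp add: tensor_def tensor_class_def tensor_square_def presented_group_carrier)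

lemma (in group) conj_by_closed:
  "g \<in> carrier G \<Longrightarrow> x \<in> carrier G \<Longrightarrow> conj_by G g x \<in> carrier G"
  by (simp add: conj_by_def)

lemma (in group) tensor_mult_left:
  assumes "g \<in> carrier G" "g' \<in> carrier G" "h \<in> carrier G"
  shows "tensor G (g \<otimes> g') h =
    tensor G (conj_by G g g') (conj_by G g h) \<otimes>\<^bsub>tensor_square G\<^esub> tensor G g h"
  unfolding tensor_def tensor_class_def tensor_square_def using assms
  by (subst presented_group_mult)
     (auto simp: pres_class_eq_iff conj_by_closed tensor_relations_def intro!: pres_eq.relation)

lemma (in group) tensor_mult_right:
  assumes "g \<in> carrier G" "h \<in> carrier G" "h' \<in> carrier G"
  shows "tensor G g (h \<otimes> h') =
    tensor G g h \<otimes>\<^bsub>tensor_square G\<^esub> tensor G (conj_by G h g) (conj_by G h h')"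
  unfolding tensor_def tensor_class_def tensor_square_def using assms
  by (subst presented_group_mult)
     (auto simp: pres_class_eq_iff conj_by_closed tensor_relations_def intro!: pres_eq.relation)

context group_hom
begin

lemma map_word_closed:
  "w \<in> words (carrier G \<times> carrier G) \<Longrightarrow>
    map (apfst (map_prod h h)) w \<in> words (carrier H \<times> carrier H)"
  by (induction w) auto

lemma tensor_relations_map:
  assumes "(u, v) \<in> tensor_relations G"
  shows "(map (apfst (map_prod h h)) u, map (apfst (map_prod h h)) v) \<in> tensor_relations H"
  using assms unfolding tensor_relations_def conj_by_def
  by (elim UnE CollectE exE conjE) (simp_all, (blast intro: hom_closed)+)

lemma tensor_eq_map:
  assumes "pres_eq (carrier G \<times> carrier G) (tensor_relations G) u v"
  shows "pres_eq (carrier H \<times> carrier H) (tensor_relations H)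
    (map (apfst (map_prod h h)) u) (map (apfst (map_prod h h)) v)"
  using assms
proof induction
  case (cancel s b)
  then show ?case by (cases s) (auto intro: pres_eq.cancel)
next
  case (relation u v)
  then show ?case
    by (intro pres_eq.relation tensor_relations_map map_word_closed)
qed (auto intro: pres_eq.intros map_word_closed)

lemma tensor_map_class:
  assumes "w \<in> words (carrier G \<times> carrier G)"
  shows "tensor_map H h (tensor_class G w) = tensor_class H (map (apfst (map_prod h h)) w)"
  unfolding tensor_map_def tensor_class_def using assms
  by (intro pres_class_Union) (auto simp: pres_class_eq_iff map_word_closed tensor_eq_map)

lemma tensor_map_hom: "tensor_map H h \<in> hom (tensor_square G) (tensor_square H)"
  by (rule homI)
     (auto simp: tensor_square_def presented_group_carrier presented_group_mult map_word_closed
        tensor_map_class[unfolded tensor_class_def])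

lemma tensor_map_tensor:
  "g \<in> carrier G \<Longrightarrow> g' \<in> carrier G \<Longrightarrow> tensor_map H h (tensor G g g') = tensor H (h g) (h g')"
  by (simp add: tensor_def tensor_map_class)

end


section \<open>Semidirect and direct products\<close>

definition internal_semidirect :: "('a, 'b) monoid_scheme \<Rightarrow> 'a set \<Rightarrow> 'a set \<Rightarrow> bool" where
  "internal_semidirect G N H \<longleftrightarrow>
    N \<lhd> G \<and> subgroup H G \<and> N \<inter> H = {\<one>\<^bsub>G\<^esub>} \<and> N <#>\<^bsub>G\<^esub> H = carrier G"

definition semidirect_proj :: "('a, 'b) monoid_scheme \<Rightarrow> 'a set \<Rightarrow> 'a set \<Rightarrow> 'a \<Rightarrow> 'a" where
  "semidirect_proj G N H x = (THE h. h \<in> H \<and> (\<exists>n\<in>N. x = n \<otimes>\<^bsub>G\<^esub> h))"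

definition semidirect_product ::
    "('a, 'c) monoid_scheme \<Rightarrow> ('b, 'd) monoid_scheme \<Rightarrow> ('b \<Rightarrow> 'a \<Rightarrow> 'a) \<Rightarrow> ('a \<times> 'b) monoid" where
  "semidirect_product K B \<phi> =
    \<lparr>carrier = carrier K \<times> carrier B,
     mult = (\<lambda>(k, b) (k', b'). (k \<otimes>\<^bsub>K\<^esub> \<phi> b k', b \<otimes>\<^bsub>B\<^esub> b')),
     one = (\<one>\<^bsub>K\<^esub>, \<one>\<^bsub>B\<^esub>)\<rparr>"

text \<open>\<open>A \<cong> K \<rtimes> B\<close> for a given normal subgroup \<^term>\<open>K\<close> of \<^term>\<open>A\<close> and some action of \<^term>\<open>B\<close> on
  \<^term>\<open>K\<close>; the isomorphism is required to identify the factor \<^term>\<open>K\<close> with the subgroup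
  \<^term>\<open>K\<close> itself.  Similarly below for \<open>A \<cong> K \<times> B\<close>.\<close>

definition splits_as_semidirect ::
    "('a, 'c) monoid_scheme \<Rightarrow> 'a set \<Rightarrow> ('b, 'd) monoid_scheme \<Rightarrow> bool" where
  "splits_as_semidirect A K B \<longleftrightarrow> K \<lhd> A \<and>
    (\<exists>\<phi> \<in> hom B (AutoGroup (A\<lparr>carrier := K\<rparr>)).
      \<exists>\<psi> \<in> iso A (semidirect_product (A\<lparr>carrier := K\<rparr>) B \<phi>). \<forall>k\<in>K. \<psi> k = (k, \<one>\<^bsub>B\<^esub>))"

definition splits_as_direct ::
    "('a, 'c) monoid_scheme \<Rightarrow> 'a set \<Rightarrow> ('b, 'd) monoid_scheme \<Rightarrow> bool" where
  "splits_as_direct A K B \<longleftrightarrow> subgroup K A \<and>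
    (\<exists>\<psi> \<in> iso A (A\<lparr>carrier := K\<rparr> \<times>\<times> B). \<forall>k\<in>K. \<psi> k = (k, \<one>\<^bsub>B\<^esub>))"

definition normal_closure :: "('a, 'b) monoid_scheme \<Rightarrow> 'a set \<Rightarrow> 'a set" where
  "normal_closure A X = \<Inter>{K. K \<lhd> A \<and> X \<subseteq> K}"

lemma semidirect_proj_eq:
  assumes "internal_semidirect G N H" "n \<in> N" "h \<in> H"
  shows "semidirect_proj G N H (n \<otimes>\<^bsub>G\<^esub> h) = h"
proof -
  interpret normal N G using assms(1) by (simp add: internal_semidirect_def)
  have H: "subgroup H G" and NH: "N \<inter> H = {\<one>\<^bsub>G\<^esub>}"
    using assms(1) by (auto simp: internal_semidirect_def)
  have "h' = h" if h': "h' \<in> H" "n' \<in> N" "n \<otimes>\<^bsub>G\<^esub> h = n' \<otimes>\<^bsub>G\<^esub> h'" for h' n'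
  proof -
    have c: "n \<in> carrier G" "n' \<in> carrier G" "h \<in> carrier G" "h' \<in> carrier G"
      using assms(2,3) h' subgroup.mem_carrier[OF H] by auto
    have "inv\<^bsub>G\<^esub> n' \<otimes>\<^bsub>G\<^esub> n = h' \<otimes>\<^bsub>G\<^esub> inv\<^bsub>G\<^esub> h"
      using h'(3) c by (metis inv_closed inv_solve_left inv_solve_right m_assoc m_closed)
    moreover have "inv\<^bsub>G\<^esub> n' \<otimes>\<^bsub>G\<^esub> n \<in> N" using assms(2) h'(2) by simp
    moreover have "h' \<otimes>\<^bsub>G\<^esub> inv\<^bsub>G\<^esub> h \<in> H"
      using h'(1) assms(3) H by (simp add: subgroup.m_closed subgroup.m_inv_closed)
    ultimately have "h' \<otimes>\<^bsub>G\<^esub> inv\<^bsub>G\<^esub> h = \<one>\<^bsub>G\<^esub>" using NH by auto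
    then show ?thesis using c by (metis inv_closed inv_equality inv_inv)
  qed
  then show ?thesis
    unfolding semidirect_proj_def using assms(2,3) by (intro the_equality) auto
qed

end

theory Submission
  imports Defs
begin

text \<open>The maps \<open>p \<otimes> p\<close> and \<open>i \<otimes> i\<close>, with \<open>i\<close> the inclusion of \<open>H\<close> in \<open>G\<close>, make \<open>H \<otimes> H\<close> a retract of
  \<open>G \<otimes> G\<close>, so every claim amounts to identifying the kernel of a retraction.  If a normal subgroup
  \<open>K\<close> lies in that kernel and every generator \<open>x\<close> is congruent modulo \<open>K\<close> to its image under
  retraction followed by section, then \<open>K\<close> is the whole kernel.  This congruence follows by writing
  \<open>g = p(g) n\<close> and \<open>h = p(h) m\<close> with \<open>n, m \<in> N\<close> and expanding \<open>g \<otimes> h\<close>.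

  Expanding \<open>g g' \<otimes> h h'\<close> in two ways shows that \<open>g \<otimes> h\<close> acts on \<open>G \<otimes> G\<close> by conjugation as the
  commutator of \<open>g\<close> and \<open>h\<close> acts diagonally.  Hence \<open>\<nabla>(G)\<close> and \<open>\<Delta>(G)\<close> are central, and sets such
  as \<open>{g \<otimes> n}\<close> are closed under conjugation, so they generate normal subgroups.\<close>

section \<open>Split epimorphisms of groups\<close>

lemma (in group) inv_cancel_left:
  assumes "x \<in> carrier G" "y \<in> carrier G"
  shows "inv x \<otimes> (x \<otimes> y) = y" and "x \<otimes> (inv x \<otimes> y) = y"
  using assms by (simp_all flip: m_assoc)

text \<open>The fourth equation holds because conjugating \<open>g h g^-1\<close> past
  \<open>g\<close> leaves \<open>g h\<close>; it brings doubly expanded tensors to a common form.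
  The fifth lets \<open>g x\<close> be rewritten with \<open>g\<close> on the right.\<close>

lemma (in group) conj_by_simps:
  assumes "g \<in> carrier G" "h \<in> carrier G" "x \<in> carrier G" "y \<in> carrier G"
  shows "conj_by G \<one> x = x"
    and "conj_by G g (conj_by G h x) = conj_by G (g \<otimes> h) x"
    and "conj_by G g (x \<otimes> y) = conj_by G g x \<otimes> conj_by G g y"
    and "conj_by G (conj_by G g h) (conj_by G g x) = conj_by G (g \<otimes> h) x"
    and "conj_by G g x \<otimes> g = g \<otimes> x"
  using assms by (simp_all add: conj_by_def m_assoc inv_mult_group inv_cancel_left)

lemma (in group) commute_generate:
  assumes "a \<in> carrier G" "X \<subseteq> carrier G" "\<And>x. x \<in> X \<Longrightarrow> a \<otimes> x = x \<otimes> a"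
    and "u \<in> generate G X"
  shows "a \<otimes> u = u \<otimes> a"
  using assms(4)
proof induction
  case (inv x)
  then have "x \<in> carrier G" using assms(2) by auto
  then show ?case
    using assms(1) assms(3)[OF inv] by (metis inv_closed inv_solve_left inv_solve_right m_assoc m_closed)
next
  case (eng x y)
  then have c: "x \<in> carrier G" "y \<in> carrier G"
    using generate_in_carrier[OF assms(2)] by auto
  have "a \<otimes> (x \<otimes> y) = x \<otimes> a \<otimes> y"
    using eng.IH(1) assms(1) c by (simp flip: m_assoc)
  then show ?case
    using eng.IH(2) assms(1) c by (simp add: m_assoc)
qed (use assms in auto)

lemma (in group) central_subgroup_normal:
  assumes "subgroup K G" "\<And>z u. z \<in> K \<Longrightarrow> u \<in> carrier G \<Longrightarrow> u \<otimes> z = z \<otimes> u"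
  shows "K \<lhd> G"
  using assms(1)
proof (rule normal_invI)
  fix x h assume "x \<in> carrier G" "h \<in> K"
  then show "x \<otimes> h \<otimes> inv x \<in> K"
    using assms(2)[of h x] subgroup.mem_carrier[OF assms(1)] by (simp add: m_assoc)
qed

lemma (in group) normal_closure_eq_generate:
  assumes "generate G X \<lhd> G" "X \<subseteq> carrier G"
  shows "normal_closure G X = generate G X"
proof
  show "generate G X \<subseteq> normal_closure G X"
    unfolding normal_closure_def
    using generate_subgroup_incl normal_imp_subgroup by blast
  show "normal_closure G X \<subseteq> generate G X"
    unfolding normal_closure_def using assms generate.incl[of _ X G] by blast
qed

lemma (in group) normal_closure_normal:
  assumes "X \<subseteq> carrier G"
  shows "normal_closure G X \<lhd> G"
proof -
  have "carrier G \<lhd> G"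
    by (simp add: normal_inv_iff subgroup_self)
  \<comment> \<open>The whole group belongs to the family, so the intersection is not over the empty
    family.\<close>
  then have ne: "{K. K \<lhd> G \<and> X \<subseteq> K} \<noteq> {}"
    using assms by blast
  have "subgroup (\<Inter> {K. K \<lhd> G \<and> X \<subseteq> K}) G"
    using ne by (intro subgroups_Inter) (auto dest: normal_imp_subgroup)
  then show ?thesis
    unfolding normal_closure_def
    by (rule normal_invI) (auto dest: normal.inv_op_closed2)
qed

lemma normal_closure_superset: "X \<subseteq> normal_closure A X"
  by (auto simp: normal_closure_def)

lemma normal_closure_minimal: "K \<lhd> A \<Longrightarrow> X \<subseteq> K \<Longrightarrow> normal_closure A X \<subseteq> K"
  by (auto simp: normal_closure_def)

lemma hom_eq_on_generate:
  assumes "group_hom A B f" "group_hom A B g" "X \<subseteq> carrier A"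
    and "\<And>x. x \<in> X \<Longrightarrow> f x = g x"
    and "a \<in> generate A X"
  shows "f a = g a"
proof -
  interpret f: group_hom A B f by fact
  interpret g: group_hom A B g by fact
  show ?thesis
    using assms(5)
    by induction (use assms(3,4) f.G.generate_in_carrier[OF assms(3)] in
        \<open>auto simp: subset_iff f.hom_inv g.hom_inv\<close>)
qed

lemma (in group) r_coset_eq_iff:
  assumes "subgroup K G" "x \<in> carrier G" "y \<in> carrier G"
  shows "K #> x = K #> y \<longleftrightarrow> x \<otimes> inv y \<in> K"
proof -
  have "K #> x = K #> y \<longleftrightarrow> x \<in> K #> y"
    using rcos_self[OF assms(2,1)] repr_independence[OF _ assms(3,1), of x] by auto
  then show ?thesis
    using subgroup.rcos_module[OF assms(1) is_group assms(3,2)] by simp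
qed

section \<open>Split epimorphisms: \<open>r\<close> is a homomorphic section of
  \<open>s\<close>\<close>

locale split_epi = epi: group_hom A B s + sec: group_hom B A r
  for A :: "('a, 'c) monoid_scheme" and B :: "('b, 'd) monoid_scheme" and s r +
  assumes s_r [simp]: "b \<in> carrier B \<Longrightarrow> s (r b) = b"
begin

text \<open>The quotient map modulo \<open>K\<close> and its composite with
  \<open>r \<circ> s\<close> are homomorphisms from \<open>A\<close> to \<open>A Mod K\<close>. They
  agree on \<open>X\<close>, hence on the subgroup generated by \<open>X\<close>; equality of the
  two cosets is the claimed membership.\<close>

lemma r_s_congruent:
  assumes "K \<lhd> A" "X \<subseteq> carrier A" "\<And>x. x \<in> X \<Longrightarrow> x \<otimes>\<^bsub>A\<^esub> inv\<^bsub>A\<^esub> r (s x) \<in> K"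
    and "a \<in> generate A X"
  shows "a \<otimes>\<^bsub>A\<^esub> inv\<^bsub>A\<^esub> r (s a) \<in> K"
proof -
  interpret K: normal K A by fact
  interpret q: group_hom A "A Mod K" "\<lambda>a. K #>\<^bsub>A\<^esub> a"
    by (simp add: group_hom_def group_hom_axioms_def K.factorgroup_is_group K.r_coset_hom_Mod
        epi.G.is_group)
  have "(\<lambda>a. r (s a)) \<in> hom A A"
    using hom_compose[OF epi.homh sec.homh] by (simp add: comp_def)
  then have "(\<lambda>a. K #>\<^bsub>A\<^esub> r (s a)) \<in> hom A (A Mod K)"
    using hom_compose[OF _ q.homh] by (simp add: comp_def)
  then have qrs: "group_hom A (A Mod K) (\<lambda>a. K #>\<^bsub>A\<^esub> r (s a))"
    by (simp add: group_hom_def group_hom_axioms_def K.factorgroup_is_group epi.G.is_group)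
  have iff: "K #>\<^bsub>A\<^esub> x = K #>\<^bsub>A\<^esub> r (s x) \<longleftrightarrow> x \<otimes>\<^bsub>A\<^esub> inv\<^bsub>A\<^esub> r (s x) \<in> K" if "x \<in> carrier A" for x
    using that by (intro epi.G.r_coset_eq_iff K.subgroup_axioms) auto
  have "K #>\<^bsub>A\<^esub> a = K #>\<^bsub>A\<^esub> r (s a)"
  proof (rule hom_eq_on_generate[OF q.group_hom_axioms qrs assms(2) _ assms(4)])
    fix x assume "x \<in> X"
    then show "K #>\<^bsub>A\<^esub> x = K #>\<^bsub>A\<^esub> r (s x)"
      using iff[of x] assms(2) assms(3)[of x] by blast
  qed
  then show ?thesis
    using iff[of a] epi.G.generate_in_carrier[OF assms(2,4)] by blast
qed

text \<open>For \<open>a\<close> in the kernel, \<open>r (s a)\<close> is trivial, so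
  \<open>r_s_congruent\<close> puts \<open>a\<close> itself into \<open>K\<close>.\<close>

lemma kernel_eqI:
  assumes "K \<lhd> A" "K \<subseteq> kernel A B s" "X \<subseteq> carrier A" "carrier A = generate A X"
    and "\<And>x. x \<in> X \<Longrightarrow> x \<otimes>\<^bsub>A\<^esub> inv\<^bsub>A\<^esub> r (s x) \<in> K"
  shows "kernel A B s = K"
proof
  show "kernel A B s \<subseteq> K"
  proof
    fix a assume "a \<in> kernel A B s"
    then show "a \<in> K"
      using r_s_congruent[OF assms(1,3,5), of a] assms(4) by (simp add: kernel_def)
  qed
qed fact

section \<open>Decomposition of \<open>A\<close> into the kernel of \<open>s\<close> and the image
  of \<open>r\<close>\<close>

lemma kernel_part:
  "a \<in> carrier A \<Longrightarrow> a \<otimes>\<^bsub>A\<^esub> inv\<^bsub>A\<^esub> r (s a) \<in> kernel A B s"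
  by (simp add: kernel_def)

lemma kernel_part_unique:
  assumes "k \<in> kernel A B s" "b \<in> carrier B"
  shows "k \<otimes>\<^bsub>A\<^esub> r b \<otimes>\<^bsub>A\<^esub> inv\<^bsub>A\<^esub> r (s (k \<otimes>\<^bsub>A\<^esub> r b)) = k" and "s (k \<otimes>\<^bsub>A\<^esub> r b) = b"
  using assms by (auto simp: kernel_def epi.G.m_assoc)

lemma bij_betw_split:
  "bij_betw (\<lambda>a. (a \<otimes>\<^bsub>A\<^esub> inv\<^bsub>A\<^esub> r (s a), s a)) (carrier A) (kernel A B s \<times> carrier B)"
proof (rule bij_betw_byWitness[where f' = "\<lambda>(k, b). k \<otimes>\<^bsub>A\<^esub> r b"])
  show "\<forall>a\<in>carrier A. (case (a \<otimes>\<^bsub>A\<^esub> inv\<^bsub>A\<^esub> r (s a), s a) of (k, b) \<Rightarrow> k \<otimes>\<^bsub>A\<^esub> r b) = a"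
    by (simp add: epi.G.m_assoc)
  show "(\<lambda>a. (a \<otimes>\<^bsub>A\<^esub> inv\<^bsub>A\<^esub> r (s a), s a)) ` carrier A \<subseteq> kernel A B s \<times> carrier B"
    using kernel_part by auto
  show "(\<lambda>(k, b). k \<otimes>\<^bsub>A\<^esub> r b) ` (kernel A B s \<times> carrier B) \<subseteq> carrier A"
    by (auto simp: kernel_def)
qed (use kernel_part_unique in auto)

text \<open>Conjugation through the section. It is restricted to the kernel because the elements of
  \<open>AutoGroup\<close> are extensional functions.\<close>

definition action :: "'b \<Rightarrow> 'a \<Rightarrow> 'a" where
  "action b = (\<lambda>k\<in>kernel A B s. r b \<otimes>\<^bsub>A\<^esub> k \<otimes>\<^bsub>A\<^esub> inv\<^bsub>A\<^esub> r b)"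

lemma action_closed:
  "b \<in> carrier B \<Longrightarrow> k \<in> kernel A B s \<Longrightarrow> action b k \<in> kernel A B s"
  by (simp add: action_def kernel_def)

lemma action_mult:
  "b \<in> carrier B \<Longrightarrow> c \<in> carrier B \<Longrightarrow> k \<in> kernel A B s \<Longrightarrow>
    action b (action c k) = action (b \<otimes>\<^bsub>B\<^esub> c) k"
  using action_closed[of c k]
  by (simp add: action_def) (simp add: kernel_def epi.G.m_assoc epi.G.inv_mult_group)

lemma action_one: "k \<in> kernel A B s \<Longrightarrow> action \<one>\<^bsub>B\<^esub> k = k"
  by (simp add: action_def kernel_def)

lemma action_hom: "action \<in> hom B (AutoGroup (A\<lparr>carrier := kernel A B s\<rparr>))"
proof -
  have auto: "action b \<in> auto (A\<lparr>carrier := kernel A B s\<rparr>)" if b: "b \<in> carrier B" for b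
  proof -
    \<comment> \<open>The action of the inverse of \<open>b\<close> is a two-sided inverse.\<close>
    have "bij_betw (action b) (kernel A B s) (kernel A B s)"
      using b
      by (intro bij_betw_byWitness[where f' = "action (inv\<^bsub>B\<^esub> b)"])
         (auto simp: action_closed action_mult action_one)
    moreover have "action b (k \<otimes>\<^bsub>A\<^esub> l) = action b k \<otimes>\<^bsub>A\<^esub> action b l"
      if "k \<in> kernel A B s" "l \<in> kernel A B s" for k l
      using that b by (simp add: action_def kernel_def epi.G.m_assoc epi.G.inv_cancel_left)
    ultimately show ?thesis
      using b by (auto simp: auto_def Bij_def action_def[of b] hom_def dest: action_closed)
  qed
  show ?thesis
  proof (rule homI)
    fix b c assume bc: "b \<in> carrier B" "c \<in> carrier B"
    have "action b \<in> Bij (kernel A B s)" "action c \<in> Bij (kernel A B s)"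
      using auto bc by (auto simp: auto_def)
    \<comment> \<open>The product in \<open>BijGroup\<close> is \<open>compose\<close>, restricted
      to the kernel. Both sides are extensional there, so comparing values on the kernel
      suffices.\<close>
    moreover have "action (b \<otimes>\<^bsub>B\<^esub> c) = compose (kernel A B s) (action b) (action c)"
      using bc by (intro extensionalityI[where A = "kernel A B s"])
        (auto simp: action_mult compose_def, simp add: action_def)
    ultimately show "action (b \<otimes>\<^bsub>B\<^esub> c) =
        action b \<otimes>\<^bsub>AutoGroup (A\<lparr>carrier := kernel A B s\<rparr>)\<^esub> action c"
      by (simp add: AutoGroup_def BijGroup_def)
  qed (simp add: AutoGroup_def auto)
qed

text \<open>The isomorphism sends \<open>a\<close> to its kernel part and its image under
  \<open>s\<close>. The kernel part of a product \<open>a a'\<close> is that of \<open>a\<close>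
  times the conjugate by \<open>r (s a)\<close> of that of \<open>a'\<close>, which is exactly the
  twisted multiplication.\<close>

theorem splits_as_semidirect_kernel: "splits_as_semidirect A (kernel A B s) B"
proof -
  let ?\<psi> = "\<lambda>a. (a \<otimes>\<^bsub>A\<^esub> inv\<^bsub>A\<^esub> r (s a), s a)"
  have "?\<psi> \<in> iso A (semidirect_product (A\<lparr>carrier := kernel A B s\<rparr>) B action)"
  proof (rule isoI)
    show "?\<psi> \<in> hom A (semidirect_product (A\<lparr>carrier := kernel A B s\<rparr>) B action)"
    proof (rule homI)
      fix a a' assume "a \<in> carrier A" "a' \<in> carrier A"
      then show "?\<psi> (a \<otimes>\<^bsub>A\<^esub> a') =
          ?\<psi> a \<otimes>\<^bsub>semidirect_product (A\<lparr>carrier := kernel A B s\<rparr>) B action\<^esub> ?\<psi> a'"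
        using kernel_part[of a']
        by (simp add: semidirect_product_def action_def epi.G.m_assoc epi.G.inv_mult_group
            epi.G.inv_cancel_left)
    qed (auto simp: semidirect_product_def kernel_part)
    show "bij_betw ?\<psi> (carrier A)
        (carrier (semidirect_product (A\<lparr>carrier := kernel A B s\<rparr>) B action))"
      using bij_betw_split by (simp add: semidirect_product_def)
  qed
  moreover have "\<forall>k\<in>kernel A B s. ?\<psi> k = (k, \<one>\<^bsub>B\<^esub>)"
    by (simp add: kernel_def)
  ultimately show ?thesis
    unfolding splits_as_semidirect_def
    by (intro conjI epi.normal_kernel bexI[OF _ action_hom] bexI[where x = ?\<psi>])
qed

text \<open>In a commutative group the conjugation action is trivial, so the same map respects the
  untwisted product.\<close>

theorem splits_as_direct_kernel:
  assumes "comm_group A"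
  shows "splits_as_direct A (kernel A B s) B"
proof -
  interpret A: comm_group A by fact
  let ?\<psi> = "\<lambda>a. (a \<otimes>\<^bsub>A\<^esub> inv\<^bsub>A\<^esub> r (s a), s a)"
  have "?\<psi> \<in> iso A (A\<lparr>carrier := kernel A B s\<rparr> \<times>\<times> B)"
  proof (rule isoI)
    show "?\<psi> \<in> hom A (A\<lparr>carrier := kernel A B s\<rparr> \<times>\<times> B)"
    proof (rule homI)
      fix a a' assume a: "a \<in> carrier A" "a' \<in> carrier A"
      \<comment> \<open>Applied with \<open>u\<close> and \<open>u'\<close> the inverses of
        \<open>r (s a)\<close> and \<open>r (s a')\<close>.\<close>
      have "a \<otimes>\<^bsub>A\<^esub> a' \<otimes>\<^bsub>A\<^esub> (u \<otimes>\<^bsub>A\<^esub> u') = a \<otimes>\<^bsub>A\<^esub> u \<otimes>\<^bsub>A\<^esub> (a' \<otimes>\<^bsub>A\<^esub> u')"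
        if "u \<in> carrier A" "u' \<in> carrier A" for u u'
        using a that by (simp add: A.m_ac)
      then show "?\<psi> (a \<otimes>\<^bsub>A\<^esub> a') = ?\<psi> a \<otimes>\<^bsub>A\<lparr>carrier := kernel A B s\<rparr> \<times>\<times> B\<^esub> ?\<psi> a'"
        using a by (simp add: DirProd_def A.inv_mult)
    qed (auto simp: DirProd_def kernel_part)
    show "bij_betw ?\<psi> (carrier A) (carrier (A\<lparr>carrier := kernel A B s\<rparr> \<times>\<times> B))"
      using bij_betw_split by (simp add: DirProd_def)
  qed
  moreover have "\<forall>k\<in>kernel A B s. ?\<psi> k = (k, \<one>\<^bsub>B\<^esub>)"
    by (simp add: kernel_def)
  ultimately show ?thesis
    unfolding splits_as_direct_def
    by (intro conjI epi.subgroup_kernel bexI[where x = ?\<psi>])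
qed

section \<open>Restriction of a split epimorphism to subgroups and passage to quotients\<close>

lemma split_epi_subgroups:
  assumes "subgroup M A" "subgroup M' B" "s ` M \<subseteq> M'" "r ` M' \<subseteq> M"
  shows "split_epi (A\<lparr>carrier := M\<rparr>) (B\<lparr>carrier := M'\<rparr>) s r"
proof -
  interpret M: subgroup M A by fact
  interpret M': subgroup M' B by fact
  show ?thesis
    using assms(3,4)
    by (auto simp: split_epi_def split_epi_axioms_def group_hom_def group_hom_axioms_def hom_def
        epi.G.subgroup_imp_group[OF assms(1)] epi.H.subgroup_imp_group[OF assms(2)])
qed

text \<open>Both maps descend by the universal property of the quotient, since each sends one normal
  subgroup into the other. The induced maps are determined by their values on cosets, and
  \<open>s' \<circ> r'\<close> is the identity because \<open>s \<circ> r\<close> is.\<close>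

lemma split_epi_quotients:
  assumes "M \<lhd> A" "M' \<lhd> B" "s ` M \<subseteq> M'" "r ` M' \<subseteq> M"
  obtains s' r' where "split_epi (A Mod M) (B Mod M') s' r'"
    and "\<And>a. a \<in> carrier A \<Longrightarrow> s' (M #>\<^bsub>A\<^esub> a) = M' #>\<^bsub>B\<^esub> s a"
    and "\<And>b. b \<in> carrier B \<Longrightarrow> r' (M' #>\<^bsub>B\<^esub> b) = M #>\<^bsub>A\<^esub> r b"
proof -
  interpret M: normal M A by fact
  interpret M': normal M' B by fact
  interpret qs: group_hom A "B Mod M'" "\<lambda>a. M' #>\<^bsub>B\<^esub> s a"
    using M'.r_coset_hom_Mod
    by (auto simp: group_hom_def group_hom_axioms_def M'.factorgroup_is_group hom_def)
  interpret qr: group_hom B "A Mod M" "\<lambda>b. M #>\<^bsub>A\<^esub> r b"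
    using M.r_coset_hom_Mod
    by (auto simp: group_hom_def group_hom_axioms_def M.factorgroup_is_group hom_def)
  have "M \<subseteq> kernel A (B Mod M') (\<lambda>a. M' #>\<^bsub>B\<^esub> s a)"
    using assms(3) M.subset
    by (auto simp: kernel_def epi.H.coset_join2 M'.subgroup_axioms image_subset_iff)
  then obtain s' where s': "s' \<in> hom (A Mod M) (B Mod M')"
    "\<And>a. a \<in> carrier A \<Longrightarrow> s' (M #>\<^bsub>A\<^esub> a) = M' #>\<^bsub>B\<^esub> s a"
    using qs.FactGroup_universal_kernel[OF assms(1)] by blast
  have "M' \<subseteq> kernel B (A Mod M) (\<lambda>b. M #>\<^bsub>A\<^esub> r b)"
    using assms(4) M'.subset
    by (auto simp: kernel_def epi.G.coset_join2 M.subgroup_axioms image_subset_iff)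
  then obtain r' where r': "r' \<in> hom (B Mod M') (A Mod M)"
    "\<And>b. b \<in> carrier B \<Longrightarrow> r' (M' #>\<^bsub>B\<^esub> b) = M #>\<^bsub>A\<^esub> r b"
    using qr.FactGroup_universal_kernel[OF assms(2)] by blast
  have "split_epi (A Mod M) (B Mod M') s' r'"
    using s' r'
    by (auto simp: split_epi_def split_epi_axioms_def group_hom_def group_hom_axioms_def
        M.factorgroup_is_group M'.factorgroup_is_group carrier_FactGroup)
  then show ?thesis using s'(2) r'(2) that by blast
qed

end

section \<open>Conjugation in the tensor square\<close>

context group
begin

interpretation T: group "tensor_square G"
  by (rule group_tensor_square)

text \<open>Induction on a representing word: a positive letter is a tensor, and by the cancellation
  rule a letter marked \<open>False\<close> is the inverse of one.\<close>

lemma carrier_tensor_square: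
  "carrier (tensor_square G) =
    generate (tensor_square G) {tensor G g h | g h. g \<in> carrier G \<and> h \<in> carrier G}"
  (is "_ = generate _ ?X")
proof
  have X: "?X \<subseteq> carrier (tensor_square G)"
    by (auto simp: tensor_closed)
  then show "generate (tensor_square G) ?X \<subseteq> carrier (tensor_square G)"
    by (rule T.generate_incl)
  have "tensor_class G w \<in> generate (tensor_square G) ?X"
    if "w \<in> words (carrier G \<times> carrier G)" for w
    using that
  proof (induction w)
    case Nil
    show ?case
      using generate.one[of "tensor_square G" ?X]
      by (simp add: tensor_class_def tensor_square_def presented_group_one)
  next
    case (Cons x w)
    obtain g h b where x: "x = ((g, h), b)" by (metis surj_pair)
    have gh: "g \<in> carrier G" "h \<in> carrier G" and w: "w \<in> words (carrier G \<times> carrier G)"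
      using Cons.prems by (auto simp: x)
    have "tensor_class G [((g, h), b)] \<in> generate (tensor_square G) ?X"
    proof (cases b)
      case True
      then show ?thesis
        using gh by (auto simp: tensor_def intro!: generate.incl)
    next
      case False
      have "tensor_class G [((g, h), False)] \<otimes>\<^bsub>tensor_square G\<^esub> tensor G g h = \<one>\<^bsub>tensor_square G\<^esub>"
        using gh pres_eq.cancel[of "(g, h)" "carrier G \<times> carrier G" "tensor_relations G" False]
        by (simp add: tensor_def tensor_class_def tensor_square_def presented_group_mult
            presented_group_one pres_class_eq_iff)
      moreover have "tensor_class G [((g, h), False)] \<in> carrier (tensor_square G)"
        using gh by (simp add: tensor_class_def tensor_square_def presented_group_carrier)
      ultimately have "inv\<^bsub>tensor_square G\<^esub> tensor G g h = tensor_class G [((g, h), False)]"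
        using gh by (intro T.inv_equality) (auto simp: tensor_closed)
      then show ?thesis
        using False gh generate.inv[of "tensor G g h" ?X "tensor_square G"] by auto
    qed
    moreover have "tensor_class G (x # w) = tensor_class G [((g, h), b)] \<otimes>\<^bsub>tensor_square G\<^esub> tensor_class G w"
      using gh w by (simp add: x tensor_class_def tensor_square_def presented_group_mult)
    ultimately show ?case
      using Cons.IH[OF w] by (auto intro: generate.eng)
  qed
  then show "carrier (tensor_square G) \<subseteq> generate (tensor_square G) ?X"
    by (auto simp: tensor_square_def presented_group_carrier tensor_class_def)
qed

text \<open>Expanding the tensor of \<open>g\<close> with \<open>\<one> \<otimes> \<one>\<close>
  shows that the element equals its own square, hence is trivial.\<close>

lemma tensor_one_right: "g \<in> carrier G \<Longrightarrow> tensor G g \<one> = \<one>\<^bsub>tensor_square G\<^esub>"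
  using tensor_mult_right[of g \<one> \<one>] T.l_cancel_one'[of "tensor G g \<one>" "tensor G g \<one>"]
  by (simp add: conj_by_def tensor_closed)

lemma tensor_one_left: "g \<in> carrier G \<Longrightarrow> tensor G \<one> g = \<one>\<^bsub>tensor_square G\<^esub>"
  using tensor_mult_left[of \<one> \<one> g] T.l_cancel_one'[of "tensor G \<one> g" "tensor G \<one> g"]
  by (simp add: conj_by_def tensor_closed)

text \<open>Compare the two ways of expanding \<open>g g' \<otimes> h h'\<close>.\<close>
lemma tensor_commute:
  assumes "g \<in> carrier G" "h \<in> carrier G" "g' \<in> carrier G" "h' \<in> carrier G"
  shows "tensor G (conj_by G (g \<otimes> h) g') (conj_by G (g \<otimes> h) h') \<otimes>\<^bsub>tensor_square G\<^esub> tensor G g h =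
    tensor G g h \<otimes>\<^bsub>tensor_square G\<^esub> tensor G (conj_by G (h \<otimes> g) g') (conj_by G (h \<otimes> g) h')"
    (is "?l \<otimes>\<^bsub>tensor_square G\<^esub> _ = _ \<otimes>\<^bsub>tensor_square G\<^esub> ?r")
proof -
  let ?a = "tensor G (conj_by G g g') (conj_by G g h)"
  let ?b = "tensor G (conj_by G h g) (conj_by G h h')"
  have c: "?l \<in> carrier (tensor_square G)" "?r \<in> carrier (tensor_square G)"
    "?a \<in> carrier (tensor_square G)" "?b \<in> carrier (tensor_square G)"
    "tensor G g h \<in> carrier (tensor_square G)"
    using assms by (simp_all add: tensor_closed conj_by_closed)
  have "tensor G (g \<otimes> g') (h \<otimes> h') = ?a \<otimes>\<^bsub>tensor_square G\<^esub> ?l \<otimes>\<^bsub>tensor_square G\<^esub> (tensor G g h \<otimes>\<^bsub>tensor_square G\<^esub> ?b)"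
    using assms by (simp add: tensor_mult_left[of g g' "h \<otimes> h'"] tensor_mult_right[of g h h']
        tensor_mult_right[of "conj_by G g g'" "conj_by G g h" "conj_by G g h'"]
        conj_by_closed conj_by_simps T.m_assoc tensor_closed)
  moreover have "tensor G (g \<otimes> g') (h \<otimes> h') = ?a \<otimes>\<^bsub>tensor_square G\<^esub> tensor G g h \<otimes>\<^bsub>tensor_square G\<^esub> (?r \<otimes>\<^bsub>tensor_square G\<^esub> ?b)"
    using assms by (simp add: tensor_mult_right[of "g \<otimes> g'" h h'] tensor_mult_left[of g g' h]
        tensor_mult_left[of "conj_by G h g" "conj_by G h g'" "conj_by G h h'"]
        conj_by_closed conj_by_simps T.m_assoc tensor_closed)
  ultimately have "?a \<otimes>\<^bsub>tensor_square G\<^esub> (?l \<otimes>\<^bsub>tensor_square G\<^esub> tensor G g h) \<otimes>\<^bsub>tensor_square G\<^esub> ?b = ?a \<otimes>\<^bsub>tensor_square G\<^esub> (tensor G g h \<otimes>\<^bsub>tensor_square G\<^esub> ?r) \<otimes>\<^bsub>tensor_square G\<^esub> ?b"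
    using c by (simp add: T.m_assoc)
  then show ?thesis
    using c by simp
qed

text \<open>Substituting into \<open>tensor_commute\<close> the conjugates of \<open>x\<close> and
  \<open>y\<close> by \<open>inv (h \<otimes> g)\<close> turns its right-hand factor into
  \<open>tensor G x y\<close>. What remains on the left is conjugation by the commutator of
  \<open>g\<close> and \<open>h\<close>.\<close>

lemma tensor_conj:
  assumes "g \<in> carrier G" "h \<in> carrier G" "x \<in> carrier G" "y \<in> carrier G"
  shows "tensor G g h \<otimes>\<^bsub>tensor_square G\<^esub> tensor G x y \<otimes>\<^bsub>tensor_square G\<^esub> inv\<^bsub>tensor_square G\<^esub> tensor G g h =
    tensor G (conj_by G (g \<otimes> h \<otimes> inv (h \<otimes> g)) x) (conj_by G (g \<otimes> h \<otimes> inv (h \<otimes> g)) y)"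
proof -
  have "conj_by G (h \<otimes> g) (conj_by G (inv (h \<otimes> g)) z) = z"
    "conj_by G (g \<otimes> h) (conj_by G (inv (h \<otimes> g)) z) = conj_by G (g \<otimes> h \<otimes> inv (h \<otimes> g)) z"
    if "z \<in> carrier G" for z
    using that assms by (simp_all add: conj_by_simps)
  then show ?thesis
    using assms tensor_commute[of g h "conj_by G (inv (h \<otimes> g)) x" "conj_by G (inv (h \<otimes> g)) y"]
    by (simp add: conj_by_closed tensor_closed T.inv_solve_right')
qed

text \<open>A generating tensor acts through a commutator by \<open>tensor_conj\<close>. Inverses
  and products in the tensor square are matched by inverses and products of the acting elements of
  \<open>G\<close>.\<close>

lemma tensor_square_conj:
  assumes "t \<in> carrier (tensor_square G)"
  obtains c where "c \<in> carrier G"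
    and "\<And>x y. x \<in> carrier G \<Longrightarrow> y \<in> carrier G \<Longrightarrow>
      t \<otimes>\<^bsub>tensor_square G\<^esub> tensor G x y \<otimes>\<^bsub>tensor_square G\<^esub> inv\<^bsub>tensor_square G\<^esub> t = tensor G (conj_by G c x) (conj_by G c y)"
proof -
  let ?P = "\<lambda>t c. \<forall>x\<in>carrier G. \<forall>y\<in>carrier G.
    t \<otimes>\<^bsub>tensor_square G\<^esub> tensor G x y \<otimes>\<^bsub>tensor_square G\<^esub> inv\<^bsub>tensor_square G\<^esub> t = tensor G (conj_by G c x) (conj_by G c y)"
  let ?X = "{tensor G g h | g h. g \<in> carrier G \<and> h \<in> carrier G}"
  have X: "?X \<subseteq> carrier (tensor_square G)"
    by (auto simp: tensor_closed)
  have ex: "\<exists>c\<in>carrier G. ?P t c" if "t \<in> ?X" for t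
    using that tensor_conj by (auto intro!: bexI[of _ "_ \<otimes> _ \<otimes> inv (_ \<otimes> _)"])
  have "t \<in> generate (tensor_square G) ?X"
    using assms carrier_tensor_square by simp
  then have "\<exists>c\<in>carrier G. ?P t c"
  proof induction
    case one
    then show ?case
      by (intro bexI[of _ \<one>]) (simp_all add: conj_by_simps tensor_closed)
  next
    case (incl t)
    then show ?case by (rule ex)
  next
    case (inv t)
    obtain c where c: "c \<in> carrier G" "?P t c"
      using ex[OF inv] by blast
    have t: "t \<in> carrier (tensor_square G)"
      using X inv by blast
    show ?case
    proof (intro bexI[of _ "inv c"] ballI)
      fix x y assume xy: "x \<in> carrier G" "y \<in> carrier G"
      \<comment> \<open>The candidate value: conjugation by \<open>t\<close> carries it to
        \<open>tensor G x y\<close>, so conjugation by the inverse of \<open>t\<close> carries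
        \<open>tensor G x y\<close> back to it.\<close>
      let ?z = "tensor G (conj_by G (inv c) x) (conj_by G (inv c) y)"
      have "t \<otimes>\<^bsub>tensor_square G\<^esub> ?z \<otimes>\<^bsub>tensor_square G\<^esub> inv\<^bsub>tensor_square G\<^esub> t = tensor G x y"
        using c xy by (simp add: conj_by_closed conj_by_simps)
      moreover have "?z \<in> carrier (tensor_square G)"
        using c xy by (simp add: conj_by_closed tensor_closed)
      ultimately show "inv\<^bsub>tensor_square G\<^esub> t \<otimes>\<^bsub>tensor_square G\<^esub> tensor G x y \<otimes>\<^bsub>tensor_square G\<^esub> inv\<^bsub>tensor_square G\<^esub> (inv\<^bsub>tensor_square G\<^esub> t) = ?z"
        using t by (simp add: T.m_assoc T.inv_cancel_left flip: \<open>t \<otimes>\<^bsub>tensor_square G\<^esub> ?z \<otimes>\<^bsub>tensor_square G\<^esub> inv\<^bsub>tensor_square G\<^esub> t = tensor G x y\<close>)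
    qed (use c in simp)
  next
    case (eng t u)
    obtain c d where cd: "c \<in> carrier G" "?P t c" "d \<in> carrier G" "?P u d"
      using eng.IH by blast
    have tu: "t \<in> carrier (tensor_square G)" "u \<in> carrier (tensor_square G)"
      using T.generate_in_carrier[OF X] eng.hyps by auto
    show ?case
    proof (intro bexI[of _ "c \<otimes> d"] ballI)
      fix x y assume xy: "x \<in> carrier G" "y \<in> carrier G"
      have "t \<otimes>\<^bsub>tensor_square G\<^esub> u \<otimes>\<^bsub>tensor_square G\<^esub> tensor G x y \<otimes>\<^bsub>tensor_square G\<^esub> inv\<^bsub>tensor_square G\<^esub> (t \<otimes>\<^bsub>tensor_square G\<^esub> u) = t \<otimes>\<^bsub>tensor_square G\<^esub> (u \<otimes>\<^bsub>tensor_square G\<^esub> tensor G x y \<otimes>\<^bsub>tensor_square G\<^esub> inv\<^bsub>tensor_square G\<^esub> u) \<otimes>\<^bsub>tensor_square G\<^esub> inv\<^bsub>tensor_square G\<^esub> t"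
        using tu xy by (simp add: T.m_assoc T.inv_mult_group tensor_closed)
      also have "\<dots> = tensor G (conj_by G (c \<otimes> d) x) (conj_by G (c \<otimes> d) y)"
        using cd xy by (simp add: conj_by_closed conj_by_simps)
      finally show "t \<otimes>\<^bsub>tensor_square G\<^esub> u \<otimes>\<^bsub>tensor_square G\<^esub> tensor G x y \<otimes>\<^bsub>tensor_square G\<^esub> inv\<^bsub>tensor_square G\<^esub> (t \<otimes>\<^bsub>tensor_square G\<^esub> u) =
        tensor G (conj_by G (c \<otimes> d) x) (conj_by G (c \<otimes> d) y)" .
    qed (use cd in simp)
  qed
  then show ?thesis using that by blast
qed

text \<open>The centralizer of \<open>t\<close> is a subgroup, so commuting with the generating
  tensors is enough.\<close>

lemma tensor_square_centralI:
  assumes "t \<in> carrier (tensor_square G)" "u \<in> carrier (tensor_square G)"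
    and "\<And>x y. x \<in> carrier G \<Longrightarrow> y \<in> carrier G \<Longrightarrow> t \<otimes>\<^bsub>tensor_square G\<^esub> tensor G x y \<otimes>\<^bsub>tensor_square G\<^esub> inv\<^bsub>tensor_square G\<^esub> t = tensor G x y"
  shows "t \<otimes>\<^bsub>tensor_square G\<^esub> u = u \<otimes>\<^bsub>tensor_square G\<^esub> t"
proof (rule T.commute_generate[OF assms(1)])
  show "u \<in> generate (tensor_square G) {tensor G g h | g h. g \<in> carrier G \<and> h \<in> carrier G}"
    using assms(2) carrier_tensor_square by simp
  fix z assume "z \<in> {tensor G g h | g h. g \<in> carrier G \<and> h \<in> carrier G}"
  then obtain x y where "z = tensor G x y" "x \<in> carrier G" "y \<in> carrier G"
    by blast
  then show "t \<otimes>\<^bsub>tensor_square G\<^esub> z = z \<otimes>\<^bsub>tensor_square G\<^esub> t"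
    using assms(1) assms(3)[of x y] by (simp add: T.inv_solve_right' tensor_closed)
qed (auto simp: tensor_closed)

text \<open>The commutator of \<open>x\<close> with itself is trivial, so by
  \<open>tensor_conj\<close> the diagonal tensor acts trivially.\<close>

lemma tensor_diagonal_central:
  assumes "x \<in> carrier G" "u \<in> carrier (tensor_square G)"
  shows "tensor G x x \<otimes>\<^bsub>tensor_square G\<^esub> u = u \<otimes>\<^bsub>tensor_square G\<^esub> tensor G x x"
  using assms by (intro tensor_square_centralI) (simp_all add: tensor_closed tensor_conj conj_by_simps)

text \<open>The two factors act through the commutators of \<open>x, y\<close> and of
  \<open>y, x\<close>, which are inverse to each other.\<close>

lemma tensor_symmetric_central:
  assumes "x \<in> carrier G" "y \<in> carrier G" "u \<in> carrier (tensor_square G)"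
  shows "tensor G x y \<otimes>\<^bsub>tensor_square G\<^esub> tensor G y x \<otimes>\<^bsub>tensor_square G\<^esub> u = u \<otimes>\<^bsub>tensor_square G\<^esub> (tensor G x y \<otimes>\<^bsub>tensor_square G\<^esub> tensor G y x)"
proof (rule tensor_square_centralI)
  fix a b assume ab: "a \<in> carrier G" "b \<in> carrier G"
  have "tensor G x y \<otimes>\<^bsub>tensor_square G\<^esub> tensor G y x \<otimes>\<^bsub>tensor_square G\<^esub> tensor G a b \<otimes>\<^bsub>tensor_square G\<^esub> inv\<^bsub>tensor_square G\<^esub> (tensor G x y \<otimes>\<^bsub>tensor_square G\<^esub> tensor G y x) =
      tensor G x y \<otimes>\<^bsub>tensor_square G\<^esub> (tensor G y x \<otimes>\<^bsub>tensor_square G\<^esub> tensor G a b \<otimes>\<^bsub>tensor_square G\<^esub> inv\<^bsub>tensor_square G\<^esub> (tensor G y x)) \<otimes>\<^bsub>tensor_square G\<^esub> inv\<^bsub>tensor_square G\<^esub> (tensor G x y)"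
    using assms ab by (simp add: T.m_assoc T.inv_mult_group tensor_closed)
  also have "\<dots> = tensor G a b"
    using assms ab
    by (simp add: tensor_conj conj_by_closed conj_by_simps m_assoc inv_mult_group inv_cancel_left)
  finally show "tensor G x y \<otimes>\<^bsub>tensor_square G\<^esub> tensor G y x \<otimes>\<^bsub>tensor_square G\<^esub> tensor G a b \<otimes>\<^bsub>tensor_square G\<^esub>
      inv\<^bsub>tensor_square G\<^esub> (tensor G x y \<otimes>\<^bsub>tensor_square G\<^esub> tensor G y x) = tensor G a b" .
qed (use assms in \<open>auto simp: tensor_closed\<close>)

text \<open>\<open>tensor G x y\<close> commutes with the central product of the two tensors;
  cancelling it on the left leaves the claim.\<close>

lemma tensor_symmetric_commute:
  assumes "x \<in> carrier G" "y \<in> carrier G"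
  shows "tensor G y x \<otimes>\<^bsub>tensor_square G\<^esub> tensor G x y = tensor G x y \<otimes>\<^bsub>tensor_square G\<^esub> tensor G y x"
proof -
  have "tensor G x y \<otimes>\<^bsub>tensor_square G\<^esub> (tensor G y x \<otimes>\<^bsub>tensor_square G\<^esub> tensor G x y) =
      tensor G x y \<otimes>\<^bsub>tensor_square G\<^esub> (tensor G x y \<otimes>\<^bsub>tensor_square G\<^esub> tensor G y x)"
    using tensor_symmetric_central[of x y "tensor G x y"] assms
    by (simp add: tensor_closed T.m_assoc)
  then show ?thesis
    using assms by (simp add: tensor_closed)
qed

section \<open>The central subgroups \<open>nabla G\<close> and \<open>Delta G\<close>\<close>

lemma nabla_subset: "nabla G \<subseteq> carrier (tensor_square G)"
  unfolding nabla_def by (rule T.generate_incl) (auto simp: tensor_closed)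

lemma Delta_subset: "Delta G \<subseteq> carrier (tensor_square G)"
  unfolding Delta_def by (rule T.generate_incl) (auto simp: tensor_closed)

lemma tensor_diagonal_in_nabla: "x \<in> carrier G \<Longrightarrow> tensor G x x \<in> nabla G"
  unfolding nabla_def by (blast intro: generate.incl)

lemma tensor_symmetric_in_Delta:
  "x \<in> carrier G \<Longrightarrow> y \<in> carrier G \<Longrightarrow> tensor G x y \<otimes>\<^bsub>tensor_square G\<^esub> tensor G y x \<in> Delta G"
  unfolding Delta_def by (blast intro: generate.incl)

lemma nabla_central:
  "z \<in> nabla G \<Longrightarrow> u \<in> carrier (tensor_square G) \<Longrightarrow> u \<otimes>\<^bsub>tensor_square G\<^esub> z = z \<otimes>\<^bsub>tensor_square G\<^esub> u"
  unfolding nabla_def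
  by (rule T.commute_generate) (auto simp: tensor_closed tensor_diagonal_central)

lemma Delta_central:
  "z \<in> Delta G \<Longrightarrow> u \<in> carrier (tensor_square G) \<Longrightarrow> u \<otimes>\<^bsub>tensor_square G\<^esub> z = z \<otimes>\<^bsub>tensor_square G\<^esub> u"
  unfolding Delta_def
  by (rule T.commute_generate) (auto simp: tensor_closed tensor_symmetric_central)

lemma subgroup_nabla: "subgroup (nabla G) (tensor_square G)"
  unfolding nabla_def by (rule T.generate_is_subgroup) (auto simp: tensor_closed)

lemma subgroup_Delta: "subgroup (Delta G) (tensor_square G)"
  unfolding Delta_def by (rule T.generate_is_subgroup) (auto simp: tensor_closed)

lemma nabla_normal: "nabla G \<lhd> tensor_square G"
  by (rule T.central_subgroup_normal[OF subgroup_nabla nabla_central])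

lemma Delta_normal: "Delta G \<lhd> tensor_square G"
  by (rule T.central_subgroup_normal[OF subgroup_Delta Delta_central])

text \<open>Full expansion by both defining relations gives two diagonal tensors, which are central,
  and a symmetric pair. The formula yields both the inclusion of \<open>Delta G\<close> in
  \<open>nabla G\<close> and the generators of the kernel in \<open>nabla G\<close>.\<close>

lemma tensor_diagonal_mult:
  assumes "x \<in> carrier G" "y \<in> carrier G"
  shows "tensor G (x \<otimes> y) (x \<otimes> y) =
    tensor G x (conj_by G x y) \<otimes>\<^bsub>tensor_square G\<^esub> tensor G (conj_by G x y) x \<otimes>\<^bsub>tensor_square G\<^esub>
    tensor G (conj_by G x (conj_by G x y)) (conj_by G x (conj_by G x y)) \<otimes>\<^bsub>tensor_square G\<^esub> tensor G x x"
proof -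
  define y' where "y' = conj_by G x y"
  have y': "y' \<in> carrier G" "x \<otimes> y = y' \<otimes> x"
    using assms by (simp_all add: y'_def conj_by_closed conj_by_simps)
  define z where "z = tensor G (conj_by G x y') (conj_by G x y')"
  have z: "z \<in> carrier (tensor_square G)"
    using assms y' by (simp add: z_def tensor_closed conj_by_closed)
  have c: "tensor G x x \<in> carrier (tensor_square G)" "tensor G x y' \<in> carrier (tensor_square G)"
    "tensor G y' x \<in> carrier (tensor_square G)"
    using assms y' by (simp_all add: tensor_closed)
  \<comment> \<open>Here \<open>conj_by G x (x \<otimes> y)\<close> equals
    \<open>x \<otimes> y'\<close>.\<close>
  have "tensor G (x \<otimes> y) (x \<otimes> y) = tensor G y' (x \<otimes> y') \<otimes>\<^bsub>tensor_square G\<^esub> tensor G x (x \<otimes> y)"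
    using assms tensor_mult_left[of x y "x \<otimes> y"] y'
    by (simp add: conj_by_simps y'_def[symmetric]) (simp add: conj_by_def m_assoc)
  also have "\<dots> = tensor G y' x \<otimes>\<^bsub>tensor_square G\<^esub> z \<otimes>\<^bsub>tensor_square G\<^esub> (tensor G x x \<otimes>\<^bsub>tensor_square G\<^esub> tensor G x y')"
    using assms y' tensor_mult_right[of y' x y'] tensor_mult_right[of x x y]
    by (simp add: z_def y'_def[symmetric]) (simp add: conj_by_def m_assoc)
  \<comment> \<open>The diagonal factors are central and the symmetric pair commutes, so the four
    factors may be reordered.\<close>
  also have "\<dots> = tensor G x y' \<otimes>\<^bsub>tensor_square G\<^esub> tensor G y' x \<otimes>\<^bsub>tensor_square G\<^esub> z \<otimes>\<^bsub>tensor_square G\<^esub> tensor G x x"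
  proof -
    have "tensor G x x \<otimes>\<^bsub>tensor_square G\<^esub> tensor G x y' = tensor G x y' \<otimes>\<^bsub>tensor_square G\<^esub> tensor G x x"
      using tensor_diagonal_central assms(1) c by blast
    moreover have "z \<otimes>\<^bsub>tensor_square G\<^esub> tensor G x y' = tensor G x y' \<otimes>\<^bsub>tensor_square G\<^esub> z"
      unfolding z_def using assms(1) y' c by (intro tensor_diagonal_central conj_by_closed)
    ultimately have "tensor G y' x \<otimes>\<^bsub>tensor_square G\<^esub> z \<otimes>\<^bsub>tensor_square G\<^esub> (tensor G x x \<otimes>\<^bsub>tensor_square G\<^esub> tensor G x y') =
        tensor G y' x \<otimes>\<^bsub>tensor_square G\<^esub> (tensor G x y' \<otimes>\<^bsub>tensor_square G\<^esub> z) \<otimes>\<^bsub>tensor_square G\<^esub> tensor G x x"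
      using z c by (metis T.m_assoc T.m_closed)
    then show ?thesis
      using z c assms y' tensor_symmetric_commute[of x y'] by (metis T.m_assoc T.m_closed)
  qed
  finally show ?thesis by (simp add: z_def y'_def)
qed

text \<open>Solving \<open>tensor_diagonal_mult\<close> for its symmetric pair expresses that pair
  by diagonal tensors and their inverses.\<close>

lemma Delta_le_nabla: "Delta G \<subseteq> nabla G"
  unfolding Delta_def
proof (rule T.generate_subgroup_incl[OF _ subgroup_nabla], clarify)
  fix x y assume xy: "x \<in> carrier G" "y \<in> carrier G"
  \<comment> \<open>Chosen so that conjugating \<open>w\<close> by \<open>x\<close> gives
    \<open>y\<close>; the pair in \<open>tensor_diagonal_mult\<close> for \<open>x\<close> and
    \<open>w\<close> is then the one for \<open>x\<close> and \<open>y\<close>.\<close>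
  define w where "w = conj_by G (inv x) y"
  have w: "w \<in> carrier G" "conj_by G x w = y"
    using xy by (simp_all add: w_def conj_by_closed conj_by_simps)
  let ?z = "tensor G (conj_by G x y) (conj_by G x y)"
  interpret N: subgroup "nabla G" "tensor_square G" by (rule subgroup_nabla)
  have "tensor G x y \<otimes>\<^bsub>tensor_square G\<^esub> tensor G y x =
      tensor G (x \<otimes> w) (x \<otimes> w) \<otimes>\<^bsub>tensor_square G\<^esub> inv\<^bsub>tensor_square G\<^esub> tensor G x x \<otimes>\<^bsub>tensor_square G\<^esub> inv\<^bsub>tensor_square G\<^esub> ?z"
    using tensor_diagonal_mult[of x w] w xy
    by (simp add: tensor_closed conj_by_closed T.m_assoc)
  then show "tensor G x y \<otimes>\<^bsub>tensor_square G\<^esub> tensor G y x \<in> nabla G"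
    using xy w by (simp add: tensor_diagonal_in_nabla conj_by_closed)
qed

end

section \<open>Semidirect products\<close>

context group_hom
begin

lemma tensor_map_group_hom: "group_hom (tensor_square G) (tensor_square H) (tensor_map H h)"
  by (simp add: group_hom_def group_hom_axioms_def group_tensor_square tensor_map_hom)

lemma tensor_map_generate:
  assumes "X \<subseteq> carrier (tensor_square G)" "tensor_map H h ` X \<subseteq> Y"
  shows "tensor_map H h ` generate (tensor_square G) X \<subseteq> generate (tensor_square H) Y"
  using assms group_hom.generate_img[OF tensor_map_group_hom assms(1)]
    group.mono_generate[OF group_tensor_square assms(2), of H] by simp

lemma tensor_map_nabla: "tensor_map H h ` nabla G \<subseteq> nabla H"
  unfolding nabla_def
  by (intro tensor_map_generate) (auto simp: tensor_closed tensor_map_tensor)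

lemma tensor_map_Delta: "tensor_map H h ` Delta G \<subseteq> Delta H"
proof -
  interpret T: group_hom "tensor_square G" "tensor_square H" "tensor_map H h"
    by (rule tensor_map_group_hom)
  show ?thesis
    unfolding Delta_def
    by (intro tensor_map_generate)
       (auto simp: tensor_closed tensor_map_tensor, blast intro: hom_closed)
qed

end

section \<open>The projection of a semidirect product and the induced retraction of tensor
  squares\<close>

locale group_semidirect = group G for G (structure) +
  fixes N H
  assumes split: "internal_semidirect G N H"
begin

abbreviation H_group where "H_group \<equiv> G\<lparr>carrier := H\<rparr>"

abbreviation proj where "proj \<equiv> semidirect_proj G N H"

sublocale N: normal N G
  using split by (simp add: internal_semidirect_def)

sublocale H: subgroup H G
  using split by (simp add: internal_semidirect_def)

text \<open>\<open>semidirect_proj\<close> is defined by factorizations with the \<open>N\<close>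
  part on the left. Conjugating by \<open>inv h\<close> moves that part to the right, so that
  expanding a tensor leaves a factor with \<open>proj x\<close> unconjugated.\<close>

lemma decompose:
  assumes "x \<in> carrier G"
  obtains n where "n \<in> N" "x = proj x \<otimes> n" "proj x \<in> H"
proof -
  have "x \<in> N <#> H"
    using assms split by (simp add: internal_semidirect_def)
  then obtain n h where nh: "n \<in> N" "h \<in> H" "x = n \<otimes> h"
    by (auto simp: set_mult_def)
  have "x = h \<otimes> (inv h \<otimes> n \<otimes> h)"
    using nh by (simp add: m_assoc inv_cancel_left)
  moreover have "inv h \<otimes> n \<otimes> h \<in> N"
    using nh N.inv_op_closed1 by simp
  moreover have "proj x = h"
    using nh semidirect_proj_eq[OF split] by simp
  ultimately show ?thesis
    using that nh(2) by simp
qed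

lemma proj_closed: "x \<in> carrier G \<Longrightarrow> proj x \<in> H"
  using decompose by blast

lemma proj_N: "n \<in> N \<Longrightarrow> proj n = \<one>"
  using semidirect_proj_eq[OF split, of n \<one>] by simp

lemma proj_H: "h \<in> H \<Longrightarrow> proj h = h"
  using semidirect_proj_eq[OF split, of \<one> h] by simp

lemma proj_group_hom: "group_hom G H_group proj"
proof -
  have "proj (x \<otimes> y) = proj x \<otimes> proj y" if xy: "x \<in> carrier G" "y \<in> carrier G" for x y
  proof -
    have "x \<in> N <#> H" "y \<in> N <#> H"
      using xy split by (simp_all add: internal_semidirect_def)
    then obtain n h m l where nh: "n \<in> N" "h \<in> H" "x = n \<otimes> h" "m \<in> N" "l \<in> H" "y = m \<otimes> l"
      by (auto simp: set_mult_def)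
    \<comment> \<open>Moving \<open>h\<close> past \<open>m\<close> conjugates \<open>m\<close>,
      which stays in the normal subgroup \<open>N\<close>.\<close>
    have "x \<otimes> y = (n \<otimes> (h \<otimes> m \<otimes> inv h)) \<otimes> (h \<otimes> l)"
      using nh by (simp add: m_assoc inv_cancel_left)
    moreover have "n \<otimes> (h \<otimes> m \<otimes> inv h) \<in> N"
      using nh N.inv_op_closed2 by simp
    ultimately show ?thesis
      using nh by (simp add: semidirect_proj_eq[OF split])
  qed
  then show ?thesis
    by (simp add: group_hom_def group_hom_axioms_def hom_def proj_closed Pi_def
        subgroup_imp_group H.subgroup_axioms)
qed

lemma inclusion_group_hom: "group_hom H_group G (\<lambda>x. x)"
  by (auto simp: group_hom_def group_hom_axioms_def hom_def subgroup_imp_group H.subgroup_axioms)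

sublocale proj: group_hom G H_group proj
  by (rule proj_group_hom)

sublocale incl: group_hom H_group G "\<lambda>x. x"
  by (rule inclusion_group_hom)

text \<open>Since \<open>proj\<close> fixes \<open>H\<close>, the composite on the tensor square of
  \<open>H\<close> is the identity on generators, hence everywhere. Although written with the
  identity function, \<open>tensor_map G (\<lambda>x. x)\<close> changes classes: it sends a class
  of words over \<open>H\<close> to the class of the same words under the relations of
  \<open>G\<close>.\<close>

lemma split_epi_tensor:
  "split_epi (tensor_square G) (tensor_square H_group)
    (tensor_map H_group proj) (tensor_map G (\<lambda>x. x))"
proof -
  interpret s: group_hom "tensor_square G" "tensor_square H_group" "tensor_map H_group proj"
    by (rule proj.tensor_map_group_hom)
  interpret r: group_hom "tensor_square H_group" "tensor_square G" "tensor_map G (\<lambda>x. x)"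
    by (rule incl.tensor_map_group_hom)
  have "(\<lambda>t. tensor_map H_group proj (tensor_map G (\<lambda>x. x) t))
      \<in> hom (tensor_square H_group) (tensor_square H_group)"
    using Group.hom_compose[OF r.homh s.homh] by (simp add: comp_def)
  then have sr: "group_hom (tensor_square H_group) (tensor_square H_group)
      (\<lambda>t. tensor_map H_group proj (tensor_map G (\<lambda>x. x) t))"
    by (simp add: group_hom_def group_hom_axioms_def group_tensor_square)
  have id: "group_hom (tensor_square H_group) (tensor_square H_group) (\<lambda>t. t)"
    by (simp add: group_hom_def group_hom_axioms_def group_tensor_square hom_def)
  have "tensor_map H_group proj (tensor_map G (\<lambda>x. x) t) = t"
    if "t \<in> carrier (tensor_square H_group)" for t
    by (rule hom_eq_on_generate[OF sr id _ _ that[unfolded proj.H.carrier_tensor_square]])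
       (auto simp: tensor_closed incl.tensor_map_tensor proj.tensor_map_tensor proj_H)
  then show ?thesis
    by (simp add: split_epi_def split_epi_axioms_def s.group_hom_axioms r.group_hom_axioms)
qed

sublocale tensor: split_epi "tensor_square G" "tensor_square H_group"
  "tensor_map H_group proj" "tensor_map G (\<lambda>x. x)"
  by (rule split_epi_tensor)

lemma r_s_tensor:
  "g \<in> carrier G \<Longrightarrow> h \<in> carrier G \<Longrightarrow>
    tensor_map G (\<lambda>x. x) (tensor_map H_group proj (tensor G g h)) = tensor G (proj g) (proj h)"
  by (simp add: proj.tensor_map_tensor incl.tensor_map_tensor proj_closed)

section \<open>Tensors with an entry in \<open>N\<close>, and the splittings of the tensor square
  and its quotients\<close>

lemma s_tensor_N:
  assumes "g \<in> carrier G" "n \<in> N"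
  shows "tensor_map H_group proj (tensor G g n) = \<one>\<^bsub>tensor_square H_group\<^esub>"
    and "tensor_map H_group proj (tensor G n g) = \<one>\<^bsub>tensor_square H_group\<^esub>"
  using assms proj.H.tensor_one_right proj.H.tensor_one_left
  by (simp_all add: proj.tensor_map_tensor proj_closed proj_N)

lemma conj_by_N: "g \<in> carrier G \<Longrightarrow> n \<in> N \<Longrightarrow> conj_by G g n \<in> N"
  by (simp add: conj_by_def N.inv_op_closed2)

text \<open>Expanding \<open>g\<close> and then \<open>h\<close> gives \<open>?a\<close>,
  \<open>?t\<close>, \<open>?b\<close> in this order, where \<open>?a\<close> and \<open>?b\<close>
  have an entry in \<open>N\<close>. Normality of \<open>K\<close> absorbs the conjugate of
  \<open>f ?b\<close> by \<open>f ?t\<close>. The map \<open>f\<close> is left open so as to cover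
  both the tensor square and its quotients.\<close>

lemma tensor_congruent_proj:
  assumes "group_hom (tensor_square G) A f" "K \<lhd> A"
    and "\<And>g n. g \<in> carrier G \<Longrightarrow> n \<in> N \<Longrightarrow> f (tensor G g n) \<in> K"
    and "\<And>g n. g \<in> carrier G \<Longrightarrow> n \<in> N \<Longrightarrow> f (tensor G n g) \<in> K"
    and "g \<in> carrier G" "h \<in> carrier G"
  shows "f (tensor G g h) \<otimes>\<^bsub>A\<^esub> inv\<^bsub>A\<^esub> f (tensor G (proj g) (proj h)) \<in> K"
proof -
  interpret f: group_hom "tensor_square G" A f by fact
  interpret K: normal K A by fact
  obtain n where n: "n \<in> N" "g = proj g \<otimes> n" "proj g \<in> H"
    using decompose[OF assms(5)] .
  obtain m where m: "m \<in> N" "h = proj h \<otimes> m" "proj h \<in> H"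
    using decompose[OF assms(6)] .
  let ?t = "tensor G (proj g) (proj h)"
  let ?a = "tensor G (conj_by G (proj g) n) (conj_by G (proj g) h)"
  let ?b = "tensor G (conj_by G (proj h) (proj g)) (conj_by G (proj h) m)"
  have c: "?t \<in> carrier (tensor_square G)" "?a \<in> carrier (tensor_square G)"
    "?b \<in> carrier (tensor_square G)"
    using n m assms(6) by (simp_all add: tensor_closed conj_by_closed)
  have "tensor G g h = ?a \<otimes>\<^bsub>tensor_square G\<^esub> tensor G (proj g) h"
    using n assms(6) tensor_mult_left[of "proj g" n h] by simp
  also have "tensor G (proj g) h = ?t \<otimes>\<^bsub>tensor_square G\<^esub> ?b"
    using n m tensor_mult_right[of "proj g" "proj h" m] by simp
  finally have "f (tensor G g h) \<otimes>\<^bsub>A\<^esub> inv\<^bsub>A\<^esub> f ?t = f ?a \<otimes>\<^bsub>A\<^esub> (f ?t \<otimes>\<^bsub>A\<^esub> f ?b \<otimes>\<^bsub>A\<^esub> inv\<^bsub>A\<^esub> f ?t)"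
    using c by (simp add: f.H.m_assoc)
  moreover have "f ?a \<in> K" "f ?b \<in> K"
    using assms(3,4,6) n m by (simp_all add: conj_by_closed conj_by_N)
  ultimately show ?thesis
    using c by (simp add: K.inv_op_closed2)
qed

lemma tensor_square_splits:
  "splits_as_semidirect (tensor_square G)
    (normal_closure (tensor_square G)
      ({tensor G g n | g n. g \<in> carrier G \<and> n \<in> N} \<union>
       {tensor G n\<^sub>1 g\<^sub>1 | n\<^sub>1 g\<^sub>1. n\<^sub>1 \<in> N \<and> g\<^sub>1 \<in> carrier G}))
    (tensor_square H_group)"
  (is "splits_as_semidirect _ (normal_closure _ ?Y) _")
proof -
  let ?K = "normal_closure (tensor_square G) ?Y"
  let ?X = "{tensor G g h | g h. g \<in> carrier G \<and> h \<in> carrier G}"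
  have Y: "?Y \<subseteq> carrier (tensor_square G)"
    by (auto simp: tensor_closed)
  have K: "?K \<lhd> tensor_square G"
    using Y by (rule tensor.epi.G.normal_closure_normal)
  have id: "group_hom (tensor_square G) (tensor_square G) (\<lambda>x. x)"
    by (simp add: group_hom_def group_hom_axioms_def group_tensor_square hom_def)
  have "kernel (tensor_square G) (tensor_square H_group) (tensor_map H_group proj) = ?K"
  proof (rule tensor.kernel_eqI[OF K _ _ carrier_tensor_square])
    show "?K \<subseteq> kernel (tensor_square G) (tensor_square H_group) (tensor_map H_group proj)"
      by (rule normal_closure_minimal[OF tensor.epi.normal_kernel])
         (auto simp: kernel_def tensor_closed s_tensor_N)
    fix t assume "t \<in> ?X"
    then obtain g h where gh: "t = tensor G g h" "g \<in> carrier G" "h \<in> carrier G"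
      by blast
    have "tensor G g h \<otimes>\<^bsub>tensor_square G\<^esub> inv\<^bsub>tensor_square G\<^esub> tensor G (proj g) (proj h) \<in> ?K"
      by (rule tensor_congruent_proj[OF id K _ _ gh(2,3)])
         (use normal_closure_superset[of ?Y "tensor_square G"] in blast)+
    then show "t \<otimes>\<^bsub>tensor_square G\<^esub> inv\<^bsub>tensor_square G\<^esub> tensor_map G (\<lambda>x. x) (tensor_map H_group proj t) \<in> ?K"
      using gh by (simp add: r_s_tensor)
  qed (auto simp: tensor_closed)
  then show ?thesis
    using tensor.splits_as_semidirect_kernel by simp
qed

text \<open>Common form of the exterior and the tilde square. Containing \<open>Delta G\<close>, the
  subgroup \<open>M\<close> makes the class of \<open>tensor G n g\<close> inverse to that of
  \<open>tensor G g n\<close>, so generators with the \<open>N\<close> entry on the right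
  suffice.\<close>

lemma quotient_splits:
  fixes M M'
  defines "X \<equiv> {M #>\<^bsub>tensor_square G\<^esub> tensor G g n | g n. g \<in> carrier G \<and> n \<in> N}"
  assumes M: "M \<lhd> tensor_square G" and M': "M' \<lhd> tensor_square H_group"
    and "tensor_map H_group proj ` M \<subseteq> M'" and "tensor_map G (\<lambda>x. x) ` M' \<subseteq> M"
    and Delta: "Delta G \<subseteq> M"
  shows "normal_closure (tensor_square G Mod M) X = generate (tensor_square G Mod M) X"
    and "splits_as_semidirect (tensor_square G Mod M) (generate (tensor_square G Mod M) X)
      (tensor_square H_group Mod M')"
proof -
  let ?Q = "tensor_square G Mod M"
  let ?K = "generate ?Q X"
  let ?Z = "{tensor G g h | g h. g \<in> carrier G \<and> h \<in> carrier G}"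
  interpret M: normal M "tensor_square G" by fact
  interpret M': normal M' "tensor_square H_group" by fact
  obtain s r where "split_epi ?Q (tensor_square H_group Mod M') s r"
    and s: "\<And>t. t \<in> carrier (tensor_square G) \<Longrightarrow>
      s (M #>\<^bsub>tensor_square G\<^esub> t) = M' #>\<^bsub>tensor_square H_group\<^esub> tensor_map H_group proj t"
    and r: "\<And>t. t \<in> carrier (tensor_square H_group) \<Longrightarrow>
      r (M' #>\<^bsub>tensor_square H_group\<^esub> t) = M #>\<^bsub>tensor_square G\<^esub> tensor_map G (\<lambda>x. x) t"
    using tensor.split_epi_quotients[OF assms(2-5)] by blast
  then interpret Q: split_epi ?Q "tensor_square H_group Mod M'" s r by simp
  interpret q: group_hom "tensor_square G" ?Q "\<lambda>t. M #>\<^bsub>tensor_square G\<^esub> t"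
    by (simp add: group_hom_def group_hom_axioms_def M.factorgroup_is_group M.r_coset_hom_Mod
        group_tensor_square)
  have X: "X \<subseteq> carrier ?Q"
    using q.hom_closed by (auto simp: X_def tensor_closed)
  have K: "?K \<lhd> ?Q"
  proof (rule Q.epi.G.normal_generateI[OF X])
    fix x u assume "x \<in> X" "u \<in> carrier ?Q"
    then obtain g n t where t: "x = M #>\<^bsub>tensor_square G\<^esub> tensor G g n" "g \<in> carrier G" "n \<in> N"
      "u = M #>\<^bsub>tensor_square G\<^esub> t" "t \<in> carrier (tensor_square G)"
      by (auto simp: X_def carrier_FactGroup)
    \<comment> \<open>Conjugation by \<open>t\<close> acts diagonally through \<open>c\<close> and
      \<open>N\<close> is normal, so the generating set \<open>X\<close> is itself closed under
      conjugation.\<close>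
    obtain c where c: "c \<in> carrier G"
      "\<And>x y. x \<in> carrier G \<Longrightarrow> y \<in> carrier G \<Longrightarrow>
        t \<otimes>\<^bsub>tensor_square G\<^esub> tensor G x y \<otimes>\<^bsub>tensor_square G\<^esub> inv\<^bsub>tensor_square G\<^esub> t = tensor G (conj_by G c x) (conj_by G c y)"
      using tensor_square_conj[OF t(5)] by blast
    have "u \<otimes>\<^bsub>?Q\<^esub> x \<otimes>\<^bsub>?Q\<^esub> inv\<^bsub>?Q\<^esub> u = M #>\<^bsub>tensor_square G\<^esub> (t \<otimes>\<^bsub>tensor_square G\<^esub> tensor G g n \<otimes>\<^bsub>tensor_square G\<^esub> inv\<^bsub>tensor_square G\<^esub> t)"
      using t by (simp add: q.hom_mult q.hom_inv tensor_closed del: mult_FactGroup)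
    also have "\<dots> = M #>\<^bsub>tensor_square G\<^esub> tensor G (conj_by G c g) (conj_by G c n)"
      using c(2)[of g n] t by simp
    finally show "u \<otimes>\<^bsub>?Q\<^esub> x \<otimes>\<^bsub>?Q\<^esub> inv\<^bsub>?Q\<^esub> u \<in> X"
      using c(1) t conj_by_closed[of c g] conj_by_N[of c n] by (auto simp: X_def)
  qed
  then show "normal_closure ?Q X = ?K"
    using X by (rule Q.epi.G.normal_closure_eq_generate)
  have left: "M #>\<^bsub>tensor_square G\<^esub> tensor G g n \<in> ?K" if "g \<in> carrier G" "n \<in> N" for g n
    using that by (auto simp: X_def intro: generate.incl)
  have right: "M #>\<^bsub>tensor_square G\<^esub> tensor G n g \<in> ?K" if "g \<in> carrier G" "n \<in> N" for g n
  proof -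
    have "tensor G n g \<otimes>\<^bsub>tensor_square G\<^esub> tensor G g n \<in> M"
      by (rule subsetD[OF Delta tensor_symmetric_in_Delta]) (use that in simp_all)
    then have "M #>\<^bsub>tensor_square G\<^esub> (tensor G n g \<otimes>\<^bsub>tensor_square G\<^esub> tensor G g n) = M"
      using that by (simp add: tensor.epi.G.coset_join2 tensor_closed M.subgroup_axioms)
    then have "(M #>\<^bsub>tensor_square G\<^esub> tensor G n g) \<otimes>\<^bsub>?Q\<^esub> (M #>\<^bsub>tensor_square G\<^esub> tensor G g n) = \<one>\<^bsub>?Q\<^esub>"
      using that q.hom_mult[of "tensor G n g" "tensor G g n"]
      by (simp add: tensor_closed del: mult_FactGroup)
    then have "inv\<^bsub>?Q\<^esub> (M #>\<^bsub>tensor_square G\<^esub> tensor G g n) = M #>\<^bsub>tensor_square G\<^esub> tensor G n g"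
      using that by (intro Q.epi.G.inv_equality q.hom_closed) (auto simp: tensor_closed)
    then show ?thesis
      using that Q.epi.G.generate_m_inv_closed[OF X left[OF that]] by simp
  qed
  have "kernel ?Q (tensor_square H_group Mod M') s = ?K"
  proof (rule Q.kernel_eqI[OF K])
    \<comment> \<open>The retraction kills every tensor with an entry in \<open>N\<close>, already
      before passing to cosets.\<close>
    have "X \<subseteq> kernel ?Q (tensor_square H_group Mod M') s"
      using X by (auto simp: X_def kernel_def s tensor_closed s_tensor_N M'.subset
          tensor.epi.H.coset_mult_one)
    then show "?K \<subseteq> kernel ?Q (tensor_square H_group Mod M') s"
      by (rule Q.epi.G.generate_subgroup_incl[OF _ Q.epi.subgroup_kernel])
    have Z: "?Z \<subseteq> carrier (tensor_square G)"
      by (auto simp: tensor_closed)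
    show "carrier ?Q = generate ?Q ((#>\<^bsub>tensor_square G\<^esub>) M ` ?Z)"
      unfolding q.generate_img[OF Z] carrier_FactGroup carrier_tensor_square[symmetric] ..
    show "(#>\<^bsub>tensor_square G\<^esub>) M ` ?Z \<subseteq> carrier ?Q"
      using Z by (simp only: carrier_FactGroup image_mono)
    fix x assume "x \<in> (#>\<^bsub>tensor_square G\<^esub>) M ` ?Z"
    then obtain g h where gh: "x = M #>\<^bsub>tensor_square G\<^esub> tensor G g h" "g \<in> carrier G" "h \<in> carrier G"
      by blast
    have "r (s x) = M #>\<^bsub>tensor_square G\<^esub> tensor G (proj g) (proj h)"
      using gh by (simp add: s r tensor_closed r_s_tensor)
    then show "x \<otimes>\<^bsub>?Q\<^esub> inv\<^bsub>?Q\<^esub> r (s x) \<in> ?K"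
      using tensor_congruent_proj[OF q.group_hom_axioms K left right gh(2,3)] gh(1) by simp
  qed
  then show "splits_as_semidirect ?Q ?K (tensor_square H_group Mod M')"
    using Q.splits_as_semidirect_kernel by simp
qed

section \<open>The direct splittings of \<open>nabla G\<close> and \<open>Delta G\<close>\<close>

lemma comm_group_nabla: "comm_group ((tensor_square G)\<lparr>carrier := nabla G\<rparr>)"
  using nabla_central nabla_subset
  by (intro group.group_comm_groupI tensor.epi.G.subgroup_imp_group subgroup_nabla) auto

lemma comm_group_Delta: "comm_group ((tensor_square G)\<lparr>carrier := Delta G\<rparr>)"
  using Delta_central Delta_subset
  by (intro group.group_comm_groupI tensor.epi.G.subgroup_imp_group subgroup_Delta) auto

lemma nabla_splits:
  "splits_as_direct ((tensor_square G)\<lparr>carrier := nabla G\<rparr>)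
    (generate (tensor_square G)
      ({tensor G g n \<otimes>\<^bsub>tensor_square G\<^esub> tensor G n g | g n. g \<in> carrier G \<and> n \<in> N} \<union>
       {tensor G n\<^sub>1 n\<^sub>1 | n\<^sub>1. n\<^sub>1 \<in> N}))
    ((tensor_square H_group)\<lparr>carrier := nabla H_group\<rparr>)"
  (is "splits_as_direct ?A (generate _ ?Y) ?B")
proof -
  let ?K = "generate (tensor_square G) ?Y"
  let ?X = "{tensor G x x | x. x \<in> carrier G}"
  interpret A: split_epi ?A ?B "tensor_map H_group proj" "tensor_map G (\<lambda>x. x)"
    by (intro tensor.split_epi_subgroups subgroup_nabla proj.H.subgroup_nabla
        proj.tensor_map_nabla incl.tensor_map_nabla)
  interpret A: comm_group ?A
    by (rule comm_group_nabla)
  have X: "?X \<subseteq> nabla G"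
    using tensor_diagonal_in_nabla by blast
  \<comment> \<open>The symmetric generators lie in \<open>Delta G\<close>, hence in
    \<open>nabla G\<close>.\<close>
  have Y: "?Y \<subseteq> nabla G"
    using subsetD[OF Delta_le_nabla tensor_symmetric_in_Delta]
    by (auto simp: tensor_diagonal_in_nabla)
  have K_A: "?K = generate ?A ?Y"
    using Y subgroup_nabla by (simp add: tensor.epi.G.generate_consistent)
  have K: "?K \<lhd> ?A"
    unfolding K_A using Y
    by (intro A.subgroup_imp_normal A.epi.G.generate_is_subgroup) simp
  have "kernel ?A ?B (tensor_map H_group proj) = ?K"
  proof (rule A.kernel_eqI[OF K])
    have "?Y \<subseteq> kernel ?A ?B (tensor_map H_group proj)"
      using Y by (auto simp: kernel_def tensor_closed s_tensor_N)
    then show "?K \<subseteq> kernel ?A ?B (tensor_map H_group proj)"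
      unfolding K_A by (rule A.epi.G.generate_subgroup_incl[OF _ A.epi.subgroup_kernel])
    show "?X \<subseteq> carrier ?A"
      using X by simp
    show "carrier ?A = generate ?A ?X"
      using X subgroup_nabla by (simp add: tensor.epi.G.generate_consistent) (simp add: nabla_def)
    fix t assume "t \<in> ?X"
    then obtain x where x: "t = tensor G x x" "x \<in> carrier G"
      by blast
    obtain n where n: "n \<in> N" "x = proj x \<otimes> n" "proj x \<in> H"
      using decompose[OF x(2)] .
    let ?h = "proj x"
    let ?n = "conj_by G ?h n"
    have N: "?n \<in> N" "conj_by G ?h ?n \<in> N"
      using n by (simp_all add: conj_by_N)
    \<comment> \<open>In \<open>tensor_diagonal_mult\<close> for \<open>?h\<close> and
      \<open>n\<close> the last factor is \<open>tensor G ?h ?h\<close>; dividing by it leaves a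
      symmetric pair and a diagonal tensor, both of them generators in \<open>?Y\<close>.\<close>
    have "t \<otimes>\<^bsub>tensor_square G\<^esub> inv\<^bsub>tensor_square G\<^esub> tensor G ?h ?h =
        tensor G ?h ?n \<otimes>\<^bsub>tensor_square G\<^esub> tensor G ?n ?h \<otimes>\<^bsub>tensor_square G\<^esub> tensor G (conj_by G ?h ?n) (conj_by G ?h ?n)"
      using tensor_diagonal_mult[of ?h n] n N x
      by (simp add: tensor_closed tensor.epi.G.m_assoc)
    moreover have "tensor G ?h ?n \<otimes>\<^bsub>tensor_square G\<^esub> tensor G ?n ?h \<in> ?K"
      "tensor G (conj_by G ?h ?n) (conj_by G ?h ?n) \<in> ?K"
      by (rule generate.incl, use N H.mem_carrier[OF n(3)] in blast)+
    ultimately have "t \<otimes>\<^bsub>tensor_square G\<^esub> inv\<^bsub>tensor_square G\<^esub> tensor G ?h ?h \<in> ?K"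
      by (simp add: generate.eng)
    \<comment> \<open>Membership in \<open>nabla G\<close> identifies the inverse taken in
      \<open>?A\<close> with the one in the tensor square.\<close>
    moreover have "tensor G ?h ?h \<in> nabla G"
      by (intro tensor_diagonal_in_nabla H.mem_carrier n(3))
    ultimately show "t \<otimes>\<^bsub>?A\<^esub> inv\<^bsub>?A\<^esub> tensor_map G (\<lambda>x. x) (tensor_map H_group proj t) \<in> ?K"
      using x by (simp add: r_s_tensor tensor.epi.G.m_inv_consistent subgroup_nabla)
  qed
  then show ?thesis
    using A.splits_as_direct_kernel[OF comm_group_nabla] by simp
qed

lemma Delta_splits:
  "splits_as_direct ((tensor_square G)\<lparr>carrier := Delta G\<rparr>)
    (kernel ((tensor_square G)\<lparr>carrier := Delta G\<rparr>) (tensor_square H_group)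
      (tensor_map H_group proj))
    ((tensor_square H_group)\<lparr>carrier := Delta H_group\<rparr>)"
proof -
  interpret split_epi "(tensor_square G)\<lparr>carrier := Delta G\<rparr>"
    "(tensor_square H_group)\<lparr>carrier := Delta H_group\<rparr>"
    "tensor_map H_group proj" "tensor_map G (\<lambda>x. x)"
    by (intro tensor.split_epi_subgroups subgroup_Delta proj.H.subgroup_Delta
        proj.tensor_map_Delta incl.tensor_map_Delta)
  show ?thesis
    \<comment> \<open>The target \<open>Delta H_group\<close> has the same identity as the whole
      tensor square of \<open>H\<close>, so both targets give the same kernel.\<close>
    using splits_as_direct_kernel[OF comm_group_Delta] by (simp add: kernel_def)
qed

end

theorem theorem3p1:
  fixes G :: "('a, 'b) monoid_scheme" and N H :: "'a set"
  assumes "group G" and "internal_semidirect G N H"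
  shows
    "splits_as_semidirect (tensor_square G)
       (normal_closure (tensor_square G)
          ({tensor G g n | g n. g \<in> carrier G \<and> n \<in> N} \<union>
           {tensor G n\<^sub>1 g\<^sub>1 | n\<^sub>1 g\<^sub>1. n\<^sub>1 \<in> N \<and> g\<^sub>1 \<in> carrier G}))
       (tensor_square (G\<lparr>carrier := H\<rparr>)) \<and>
     splits_as_semidirect (exterior_square G)
       (normal_closure (exterior_square G)
          {wedge G g n | g n. g \<in> carrier G \<and> n \<in> N})
       (exterior_square (G\<lparr>carrier := H\<rparr>)) \<and>
     splits_as_direct ((tensor_square G)\<lparr>carrier := nabla G\<rparr>)
       (generate (tensor_square G)
          ({tensor G g n \<otimes>\<^bsub>tensor_square G\<^esub> tensor G n g | g n. g \<in> carrier G \<and> n \<in> N} \<union>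
           {tensor G n\<^sub>1 n\<^sub>1 | n\<^sub>1. n\<^sub>1 \<in> N}))
       ((tensor_square (G\<lparr>carrier := H\<rparr>))\<lparr>carrier := nabla (G\<lparr>carrier := H\<rparr>)\<rparr>) \<and>
     splits_as_direct ((tensor_square G)\<lparr>carrier := Delta G\<rparr>)
       (kernel ((tensor_square G)\<lparr>carrier := Delta G\<rparr>) (tensor_square (G\<lparr>carrier := H\<rparr>))
          (tensor_map (G\<lparr>carrier := H\<rparr>) (semidirect_proj G N H)))
       ((tensor_square (G\<lparr>carrier := H\<rparr>))\<lparr>carrier := Delta (G\<lparr>carrier := H\<rparr>)\<rparr>) \<and>
     splits_as_semidirect (tilde_square G)
       (generate (tilde_square G)
          {Delta G #>\<^bsub>tensor_square G\<^esub> tensor G g n | g n. g \<in> carrier G \<and> n \<in> N})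
       (tilde_square (G\<lparr>carrier := H\<rparr>))"
proof -
  interpret group_semidirect G N H
    using assms by (simp add: group_semidirect_def group_semidirect_axioms_def)
  show ?thesis
    \<comment> \<open>\<open>quotient_splits\<close> is used with \<open>M\<close> equal to
      \<open>nabla G\<close> and to \<open>Delta G\<close>. The exterior square also needs its first
      conclusion, that the normal closure is the generated subgroup.\<close>
    using tensor_square_splits nabla_splits Delta_splits
      quotient_splits[OF nabla_normal proj.H.nabla_normal proj.tensor_map_nabla
        incl.tensor_map_nabla Delta_le_nabla]
      quotient_splits[OF Delta_normal proj.H.Delta_normal proj.tensor_map_Delta
        incl.tensor_map_Delta subset_refl]
    by (simp add: exterior_square_def tilde_square_def wedge_def)
qed

end
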